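(* For every $n\ge1$, each of the cones $LPM_n$, $TPM_n$, and their Hermitian counterparts $LPM_n^{\mathbb{C}}$, $TPM_n^{\mathbb{C}}$, can be given the structure of a complete separable abelian (metric) group and a Riemannian manifold, with a bi-invariant metric, such that the positive definite cone ($PD_n$, resp. $PD_n^{\mathbb{C}}$ in the Hermitian case), together with the log-Cholesky metric, is the identity-component subgroup, of index $2^n$. However, none of these groups embeds in any Banach space (i.e. there is no injective group homomorphism from any of these groups into the additive group of a Banach space).
   Context: $LPM_n$ (resp. $TPM_n$): real symmetric $n\times n$ matrices all of whose leading (resp. trailing) principal minors are nonzero; $LPM_n^{\mathbb{C}},TPM_n^{\mathbb{C}}$: the same for Hermitian matrices. They are open in the symmetric (Hermitian) matrices and carry the corresponding topology and smooth structure. $PD_n$ ($PD_n^{\mathbb{C}}$): real symmetric (Hermitian) positive definite $n\times n$ matrices. Let $\mathbf{L}_n$ ($\mathbf{L}_n^{\mathbb{C}}$) be the real (complex) lower triangular matrices with positive real diagonal, with abelian group operation $L\circledcirc K=\lfloor L\rfloor+\lfloor K\rfloor+\mathbb{D}(L)\mathbb{D}(K)$ ($\lfloor\cdot\rfloor$ = strictly lower triangular part, $\mathbb{D}(\cdot)$ = diagonal part) and Riemannian metric $\widetilde g_L(X,Y)=\mathrm{Re}\sum_{i>j}\overline{x_{ij}}y_{ij}+\sum_jx_{jj}y_{jj}l_{jj}^{-2}$, whose distance is $d(L,K)=\big(\sum_{i>j}|l_{ij}-k_{ij}|^2+\sum_j(\log l_{jj}-\log k_{jj})^2\big)^{1/2}$.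 The log-Cholesky group structure, Riemannian metric and distance on $PD_n$ ($PD_n^{\mathbb{C}}$) are the transports of these along the Cholesky diffeomorphism $L\mapsto LL^*$ (for the TPM cones, along $L\mapsto L^*L$). The bi-invariant (distance) metric on the whole group restricts to this distance on the positive definite cone. *)

theory Defs
  imports "HOL-Analysis.Analysis" "HOL-Algebra.Coset" "Jordan_Normal_Form.Conjugate"
begin

section \<open>Matrices over the real or complex numbers\<close>

text \<open>
  The real and the Hermitian case are treated simultaneously: the entries have a type \<open>'k\<close>
  which is instantiated to \<open>real\<close> (where \<open>conjugate\<close> is the identity) or to \<open>complex\<close> (where
  it is \<open>cnj\<close>). The order on \<open>complex\<close> is the one of \<open>HOL-Library.Complex_Order\<close>, so
  \<open>0 < z\<close> means that \<open>z\<close> is real and positive. The index type \<open>'n\<close> is an arbitrary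
  finite linear order; it plays the role of \<open>{1,...,n}\<close> with \<open>n = CARD('n)\<close>.
\<close>

type_synonym ('k, 'n) sqmat = "(('k, 'n) vec, 'n) vec"

definition re :: "'k::{real_normed_field,real_inner} \<Rightarrow> real"
  where "re x = x \<bullet> 1"

lemma re_real [simp]: "re (x::real) = x"
  by (simp add: re_def)

lemma re_complex [simp]: "re (z::complex) = Re z"
  by (simp add: re_def inner_complex_def)

definition conj_transpose :: "'k::conjugate^'n^'m \<Rightarrow> 'k^'m^'n"
  where "conj_transpose A = (\<chi> i j. conjugate (A $ j $ i))"

definition hermitian :: "('k::conjugate, 'n::finite) sqmat set"
  where "hermitian = {A. conj_transpose A = A}"

text \<open>The determinant of the submatrix with rows and columns in \<open>S\<close> (cf. \<open>det_def\<close>).\<close>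

definition principal_minor :: "('k::comm_ring_1, 'n::finite) sqmat \<Rightarrow> 'n set \<Rightarrow> 'k"
  where "principal_minor A S =
    (\<Sum>p | p permutes S. of_int (sign p) * (\<Prod>i\<in>S. A $ i $ p i))"

definition LPM :: "('k::conjugatable_field, 'n::{finite,linorder}) sqmat set"
  where "LPM = {A \<in> hermitian. \<forall>k. principal_minor A {..k} \<noteq> 0}"

definition TPM :: "('k::conjugatable_field, 'n::{finite,linorder}) sqmat set"
  where "TPM = {A \<in> hermitian. \<forall>k. principal_minor A {k..} \<noteq> 0}"

definition PD :: "('k::conjugatable_ordered_field, 'n::finite) sqmat set"
  where "PD = {A \<in> hermitian.
    \<forall>x. x \<noteq> 0 \<longrightarrow> 0 < (\<Sum>i\<in>UNIV. \<Sum>j\<in>UNIV. conjugate (x $ i) * A $ i $ j * x $ j)}"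


section \<open>Lower triangular matrices with positive diagonal\<close>

definition lower_pos :: "('k::conjugatable_ordered_field, 'n::{finite,linorder}) sqmat set"
  where "lower_pos = {L. (\<forall>i j. i < j \<longrightarrow> L $ i $ j = 0) \<and> (\<forall>j. 0 < L $ j $ j)}"

text \<open>The tangent space of \<open>lower_pos\<close> at each of its points.\<close>

definition lower_tangent :: "('k::real_normed_field, 'n::{finite,linorder}) sqmat set"
  where "lower_tangent = {X. (\<forall>i j. i < j \<longrightarrow> X $ i $ j = 0) \<and> (\<forall>j. X $ j $ j \<in> \<real>)}"

definition strict_lower :: "('k::zero, 'n::{finite,linorder}) sqmat \<Rightarrow> ('k, 'n) sqmat"
  where "strict_lower L = (\<chi> i j. if j < i then L $ i $ j else 0)"

definition diag_part :: "('k::zero, 'n::finite) sqmat \<Rightarrow> ('k, 'n) sqmat"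
  where "diag_part L = (\<chi> i j. if i = j then L $ i $ j else 0)"

definition lower_mult ::
  "('k::semiring_1, 'n::{finite,linorder}) sqmat \<Rightarrow> ('k, 'n) sqmat \<Rightarrow> ('k, 'n) sqmat"
  where "lower_mult L K = strict_lower L + strict_lower K + diag_part L ** diag_part K"

definition lower_metric ::
  "('k::{conjugatable_ordered_field,real_normed_field,real_inner}, 'n::{finite,linorder}) sqmat
    \<Rightarrow> ('k, 'n) sqmat \<Rightarrow> ('k, 'n) sqmat \<Rightarrow> real"
  where "lower_metric L X Y =
    re (\<Sum>(i, j) | j < i. conjugate (X $ i $ j) * Y $ i $ j)
    + (\<Sum>j\<in>UNIV. re (X $ j $ j) * re (Y $ j $ j) / (re (L $ j $ j))\<^sup>2)"

definition lower_dist ::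
  "('k::{real_normed_field,real_inner}, 'n::{finite,linorder}) sqmat \<Rightarrow> ('k, 'n) sqmat \<Rightarrow> real"
  where "lower_dist L K =
    sqrt ((\<Sum>(i, j) | j < i. (norm (L $ i $ j - K $ i $ j))\<^sup>2)
      + (\<Sum>j\<in>UNIV. (ln (re (L $ j $ j)) - ln (re (K $ j $ j)))\<^sup>2))"


section \<open>The log-Cholesky structure on the positive definite cone\<close>

text \<open>
  The map \<open>\<Phi>\<close> is one of the two Cholesky maps below, which are bijections from
  \<open>lower_pos\<close> onto \<open>PD\<close>; the first belongs to \<open>LPM\<close>, the second to \<open>TPM\<close>.
\<close>

definition cholesky_LPM ::
  "('k::conjugatable_field, 'n::finite) sqmat \<Rightarrow> ('k, 'n) sqmat"
  where "cholesky_LPM L = L ** conj_transpose L"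

definition cholesky_TPM ::
  "('k::conjugatable_field, 'n::finite) sqmat \<Rightarrow> ('k, 'n) sqmat"
  where "cholesky_TPM L = conj_transpose L ** L"

definition cholesky_factor ::
  "(('k::conjugatable_ordered_field, 'n::{finite,linorder}) sqmat \<Rightarrow> ('k, 'n) sqmat)
    \<Rightarrow> ('k, 'n) sqmat \<Rightarrow> ('k, 'n) sqmat"
  where "cholesky_factor \<Phi> = the_inv_into lower_pos \<Phi>"

definition log_cholesky_mult ::
  "(('k::conjugatable_ordered_field, 'n::{finite,linorder}) sqmat \<Rightarrow> ('k, 'n) sqmat)
    \<Rightarrow> ('k, 'n) sqmat \<Rightarrow> ('k, 'n) sqmat \<Rightarrow> ('k, 'n) sqmat"
  where "log_cholesky_mult \<Phi> A B =
    \<Phi> (lower_mult (cholesky_factor \<Phi> A) (cholesky_factor \<Phi> B))"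

definition log_cholesky_dist ::
  "(('k::{conjugatable_ordered_field,real_normed_field,real_inner}, 'n::{finite,linorder}) sqmat
    \<Rightarrow> ('k, 'n) sqmat) \<Rightarrow> ('k, 'n) sqmat \<Rightarrow> ('k, 'n) sqmat \<Rightarrow> real"
  where "log_cholesky_dist \<Phi> A B = lower_dist (cholesky_factor \<Phi> A) (cholesky_factor \<Phi> B)"

text \<open>
  The Riemannian metric on \<open>PD\<close> for which \<open>\<Phi>\<close> is an isometry: tangent vectors at \<open>A = \<Phi> L\<close>
  are pulled back along the differential of \<open>\<Phi>\<close> at \<open>L\<close>.
\<close>

definition log_cholesky_metric ::
  "(('k::{conjugatable_ordered_field,real_normed_field,real_inner}, 'n::{finite,linorder}) sqmat
    \<Rightarrow> ('k, 'n) sqmat) \<Rightarrow> ('k, 'n) sqmat \<Rightarrow> ('k, 'n) sqmat \<Rightarrow> ('k, 'n) sqmat \<Rightarrow> real"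
  where "log_cholesky_metric \<Phi> A X Y =
    (let L = cholesky_factor \<Phi> A;
         D = the_inv_into lower_tangent (frechet_derivative \<Phi> (at L))
     in lower_metric L (D X) (D Y))"


section \<open>Smooth structures on relatively open subsets of a linear subspace\<close>

text \<open>
  Here \<open>V\<close> is a linear subspace and \<open>U\<close> is relatively open in \<open>V\<close>, so that \<open>V\<close> is the tangent
  space of \<open>U\<close> at each point, and derivatives within \<open>U\<close> are uniquely determined on \<open>V\<close>.
\<close>

fun Ck_on :: "nat \<Rightarrow> 'a::real_normed_vector set \<Rightarrow> 'a set \<Rightarrow> ('a \<Rightarrow> 'b::real_normed_vector) \<Rightarrow> bool"
  where
    "Ck_on 0 V U f \<longleftrightarrow> continuous_on U f"
  | "Ck_on (Suc k) V U f \<longleftrightarrow>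
      (\<exists>f'. (\<forall>x\<in>U. (f has_derivative f' x) (at x within U))
        \<and> (\<forall>v\<in>V. Ck_on k V U (\<lambda>x. f' x v)))"

definition smooth_on ::
  "'a::real_normed_vector set \<Rightarrow> 'a set \<Rightarrow> ('a \<Rightarrow> 'b::real_normed_vector) \<Rightarrow> bool"
  where "smooth_on V U f \<longleftrightarrow> (\<forall>k. Ck_on k V U f)"

definition inner_product_on :: "'a::real_vector set \<Rightarrow> ('a \<Rightarrow> 'a \<Rightarrow> real) \<Rightarrow> bool"
  where "inner_product_on V b \<longleftrightarrow>
    (\<forall>x\<in>V. \<forall>y\<in>V. b x y = b y x)
    \<and> (\<forall>x\<in>V. \<forall>y\<in>V. \<forall>z\<in>V. b (x + y) z = b x z + b y z)
    \<and> (\<forall>c. \<forall>x\<in>V. \<forall>y\<in>V. b (c *\<^sub>R x) y = c * b x y)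
    \<and> (\<forall>x\<in>V. x \<noteq> 0 \<longrightarrow> 0 < b x x)"

definition riemannian_metric_on ::
  "'a::real_normed_vector set \<Rightarrow> 'a set \<Rightarrow> ('a \<Rightarrow> 'a \<Rightarrow> 'a \<Rightarrow> real) \<Rightarrow> bool"
  where "riemannian_metric_on V U g \<longleftrightarrow>
    subspace V \<and> openin (top_of_set V) U
    \<and> (\<forall>x\<in>U. inner_product_on V (g x))
    \<and> (\<forall>v\<in>V. \<forall>w\<in>V. smooth_on V U (\<lambda>x. g x v w))"

definition lie_group_on :: "'a::real_normed_vector set \<Rightarrow> 'a monoid \<Rightarrow> bool"
  where "lie_group_on V G \<longleftrightarrow>
    group G \<and> subspace V \<and> openin (top_of_set V) (carrier G)
    \<and> smooth_on (V \<times> V) (carrier G \<times> carrier G) (\<lambda>(x, y). x \<otimes>\<^bsub>G\<^esub> y)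
    \<and> smooth_on V (carrier G) (\<lambda>x. inv\<^bsub>G\<^esub> x)"

definition isometric_on ::
  "'a::real_normed_vector set \<Rightarrow> 'a set \<Rightarrow> ('a \<Rightarrow> 'a \<Rightarrow> 'a \<Rightarrow> real) \<Rightarrow> ('a \<Rightarrow> 'a) \<Rightarrow> bool"
  where "isometric_on V U g f \<longleftrightarrow>
    (\<forall>x\<in>U. \<exists>f'. (f has_derivative f') (at x within U)
      \<and> (\<forall>v\<in>V. \<forall>w\<in>V. g (f x) (f' v) (f' w) = g x v w))"

definition bi_invariant_riemannian ::
  "'a::real_normed_vector set \<Rightarrow> 'a monoid \<Rightarrow> ('a \<Rightarrow> 'a \<Rightarrow> 'a \<Rightarrow> real) \<Rightarrow> bool"
  where "bi_invariant_riemannian V G g \<longleftrightarrow>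
    (\<forall>a\<in>carrier G. isometric_on V (carrier G) g (\<lambda>x. a \<otimes>\<^bsub>G\<^esub> x)
      \<and> isometric_on V (carrier G) g (\<lambda>x. x \<otimes>\<^bsub>G\<^esub> a))"

definition bi_invariant_dist :: "'a monoid \<Rightarrow> ('a \<Rightarrow> 'a \<Rightarrow> real) \<Rightarrow> bool"
  where "bi_invariant_dist G d \<longleftrightarrow>
    (\<forall>a\<in>carrier G. \<forall>x\<in>carrier G. \<forall>y\<in>carrier G.
      d (a \<otimes>\<^bsub>G\<^esub> x) (a \<otimes>\<^bsub>G\<^esub> y) = d x y \<and> d (x \<otimes>\<^bsub>G\<^esub> a) (y \<otimes>\<^bsub>G\<^esub> a) = d x y)"


section \<open>Extending the log-Cholesky structure to a larger cone\<close>

text \<open>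
  \<open>G\<close> is a group structure, \<open>d\<close> a distance and \<open>g\<close> a Riemannian metric on the cone \<open>M\<close>. Both the
  topology and the smooth structure are those inherited from the Hermitian matrices. The
  distance is defined on all of \<open>M\<close>, also between points of different components.
\<close>

definition log_cholesky_extension ::
  "(('k::{conjugatable_ordered_field,real_normed_field,real_inner}, 'n::{finite,linorder}) sqmat
    \<Rightarrow> ('k, 'n) sqmat) \<Rightarrow> ('k, 'n) sqmat set \<Rightarrow> ('k, 'n) sqmat monoid
    \<Rightarrow> (('k, 'n) sqmat \<Rightarrow> ('k, 'n) sqmat \<Rightarrow> real)
    \<Rightarrow> (('k, 'n) sqmat \<Rightarrow> ('k, 'n) sqmat \<Rightarrow> ('k, 'n) sqmat \<Rightarrow> real) \<Rightarrow> bool"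
  where "log_cholesky_extension \<Phi> M G d g \<longleftrightarrow>
    carrier G = M \<and> comm_group G \<and> lie_group_on hermitian G
    \<and> Metric_space M d
    \<and> Metric_space.mtopology M d = top_of_set M
    \<and> Metric_space.mcomplete M d
    \<and> separable_space (Metric_space.mtopology M d)
    \<and> bi_invariant_dist G d
    \<and> riemannian_metric_on hermitian M g
    \<and> bi_invariant_riemannian hermitian G g
    \<and> subgroup PD G
    \<and> connected_component_set M \<one>\<^bsub>G\<^esub> = PD
    \<and> card (rcosets\<^bsub>G\<^esub> PD) = 2 ^ CARD('n)
    \<and> (\<forall>A\<in>PD. \<forall>B\<in>PD. A \<otimes>\<^bsub>G\<^esub> B = log_cholesky_mult \<Phi> A B)
    \<and> (\<forall>A\<in>PD. \<forall>B\<in>PD. d A B = log_cholesky_dist \<Phi> A B)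
    \<and> (\<forall>A\<in>PD. \<forall>X\<in>hermitian. \<forall>Y\<in>hermitian. g A X Y = log_cholesky_metric \<Phi> A X Y)"

definition additive_group :: "'b::ab_group_add monoid"
  where "additive_group = \<lparr>carrier = UNIV, monoid.mult = (+), one = 0\<rparr>"

end

theory Submission
  imports Defs "HOL-Algebra.Multiplicative_Group"
begin

text \<open>
  Each cone is the diffeomorphic image of the lower triangular matrices with nonzero real diagonal:
  every matrix with nonzero leading principal minors is \<open>L D L\<^sup>*\<close> for a unique \<open>L\<close> in
  \<open>lower_pos\<close> and a unique diagonal sign matrix \<open>D\<close>, and the signs are recorded on the diagonal of
  the triangular matrix. The group law \<open>lower_mult\<close> and the metric \<open>lower_metric\<close> make sense for
  nonzero diagonals as well, so they can be transported to the whole cone; the sign vector is the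
  coset of \<open>PD\<close>. For the distance, the triangular matrices are embedded as a closed set into a
  Euclidean space by the logarithm of the absolute values of the diagonal together with the signs.

  No group with these properties embeds in a vector space: the subgroup \<open>PD\<close> is divisible, proper
  and of finite index, so the group has torsion.
\<close>

section \<open>Calculus on relatively open subsets of a subspace\<close>

text \<open>The delicate point is a smooth inverse of the factorization. At index \<open>j\<close>
  the pivot, an entry of a Schur complement, equals \<open>l * |l|\<close> for the signed diagonal
  entry \<open>l\<close> of the factor. Nonvanishing minors keep every pivot nonzero, and there its
  sign is locally constant and the root of its absolute value is smooth, so columns can be recovered
  one at a time; this one recursion underlies existence, uniqueness and smoothness. Trailing minors
  run through it in the reversed order. Smoothness is meant on relatively open subsets of a
  subspace, where a derivative is determined on that subspace only; hence derivatives have to be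
  confined to tangent directions. For the distance, logarithms send diagonal entries near zero to
  infinity, which gives completeness, and the signs make the map injective. The torsion argument
  must cover every structure with the required properties, of which only the law on
  \<open>PD\<close> is explicit. With \<open>N = 2 ^ n\<close>, an element \<open>a\<close> outside
  \<open>PD\<close> has \<open>a ^ N\<close> in \<open>PD\<close>, hence
  \<open>a ^ N = c ^ N\<close> for some \<open>c\<close> in \<open>PD\<close>; homomorphisms to a
  vector space cannot separate \<open>a\<close> from \<open>c\<close>.\<close>

lemma has_derivative_imp_directional:
  assumes "(f has_derivative f') (at x within U)" "x \<in> U" "v \<in> V"
    and "openin (top_of_set V) U" "subspace V"
  shows "((\<lambda>t. (f (x + t *\<^sub>R v) - f x) /\<^sub>R t) \<longlongrightarrow> f' v) (at 0)"
    and "eventually (\<lambda>t. x + t *\<^sub>R v \<in> U) (at 0)"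
proof -
  obtain T where T: "open T" "U = V \<inter> T"
    using assms(4) by (auto simp: openin_open)
  \<comment> \<open>An open set of parameters for which the line through \<open>x\<close> in
    direction \<open>v\<close> stays in \<open>U\<close>; on it the chain rule reduces
    \<open>f\<close> to a function of one real variable.\<close>
  define S where "S = (\<lambda>t. x + t *\<^sub>R v) -` T"
  have "open S"
    unfolding S_def using T(1) by (intro open_vimage continuous_intros)
  have sub: "x + t *\<^sub>R v \<in> U" if "t \<in> S" for t
  proof -
    have "x \<in> V" using assms(2) T by auto
    then have "x + t *\<^sub>R v \<in> V"
      using assms(3,5) by (simp add: subspace_add subspace_scale)
    then show ?thesis using that T by (simp add: S_def)
  qed
  have "0 \<in> S" using assms(2) T by (simp add: S_def)
  then show "eventually (\<lambda>t. x + t *\<^sub>R v \<in> U) (at 0)"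
    using eventually_at_topological \<open>open S\<close> sub by blast
  have lin: "((\<lambda>t. x + t *\<^sub>R v) has_derivative (\<lambda>t. t *\<^sub>R v)) (at 0 within S)"
    by (auto intro!: derivative_eq_intros)
  have im: "(f has_derivative f') (at (x + 0 *\<^sub>R v) within (\<lambda>t. x + t *\<^sub>R v) ` S)"
    by (rule has_derivative_subset[where s = U]) (use sub assms(1) in auto)
  have "((\<lambda>t. f (x + t *\<^sub>R v)) has_derivative (\<lambda>t. f' (t *\<^sub>R v))) (at 0 within S)"
    by (rule has_derivative_in_compose[of "\<lambda>t. x + t *\<^sub>R v" "\<lambda>t. t *\<^sub>R v" 0 S f f', OF lin im])
  then have D: "((\<lambda>t. f (x + t *\<^sub>R v)) has_derivative (\<lambda>t. f' (t *\<^sub>R v))) (at 0)"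
    unfolding at_within_open[OF \<open>0 \<in> S\<close> \<open>open S\<close>] .
  have "linear f'" using assms(1) has_derivative_linear by blast
  then have "(\<lambda>t. f' (t *\<^sub>R v)) = (\<lambda>t. t *\<^sub>R f' v)"
    by (simp add: linear_cmul)
  then have "((\<lambda>t. f (x + t *\<^sub>R v)) has_vector_derivative f' v) (at 0)"
    using D by (simp add: has_vector_derivative_def)
  then show "((\<lambda>t. (f (x + t *\<^sub>R v) - f x) /\<^sub>R t) \<longlongrightarrow> f' v) (at 0)"
    unfolding has_vector_derivative_def has_derivative_at
  proof (elim conjE)
    assume "(\<lambda>h. norm (f (x + (0 + h) *\<^sub>R v) - f (x + 0 *\<^sub>R v) - h *\<^sub>R f' v) / norm h) \<midarrow>0\<rightarrow> 0"
    moreover have "norm (f (x + (0 + h) *\<^sub>R v) - f (x + 0 *\<^sub>R v) - h *\<^sub>R f' v) / norm h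
        = norm ((f (x + h *\<^sub>R v) - f x) /\<^sub>R h - f' v)" if "h \<noteq> 0" for h
    proof -
      have "(f (x + h *\<^sub>R v) - f x) /\<^sub>R h - f' v = (f (x + h *\<^sub>R v) - f x - h *\<^sub>R f' v) /\<^sub>R h"
        using that by (simp add: algebra_simps)
      then show ?thesis by (simp add: divide_inverse_commute)
    qed
    ultimately have "(\<lambda>h. norm ((f (x + h *\<^sub>R v) - f x) /\<^sub>R h - f' v)) \<midarrow>0\<rightarrow> 0"
      by (subst (asm) tendsto_cong) (auto simp: eventually_at_filter)
    then show ?thesis
      by (rule LIM_zero_cancel[OF tendsto_norm_zero_cancel])
  qed
qed

text \<open>Both values are the limit of the same difference quotients along \<open>v\<close>. Off
  \<open>V\<close> nothing can be said: a derivative within \<open>U\<close> is not determined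
  there.\<close>

lemma has_derivative_unique_on_subspace:
  assumes "(f has_derivative f') (at x within U)" "(f has_derivative f'') (at x within U)"
    and "x \<in> U" "v \<in> V" "openin (top_of_set V) U" "subspace V"
  shows "f' v = f'' v"
  using has_derivative_imp_directional(1)[OF assms(1) assms(3-6)]
    has_derivative_imp_directional(1)[OF assms(2) assms(3-6)]
  by (rule tendsto_unique[rotated]) simp

text \<open>The difference quotients lie in \<open>W\<close>, and closedness keeps their limit
  there. The chain rule depends on this, since the outer function is only controlled in directions
  of \<open>W\<close>.\<close>

lemma has_derivative_in_subspace:
  assumes "(f has_derivative f') (at x within U)"
    and "x \<in> U" "v \<in> V" "openin (top_of_set V) U" "subspace V"
    and "f ` U \<subseteq> W" "subspace W" "closed W"
  shows "f' v \<in> W"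
proof (rule Lim_in_closed_set[OF assms(8)])
  show "((\<lambda>t. (f (x + t *\<^sub>R v) - f x) /\<^sub>R t) \<longlongrightarrow> f' v) (at 0)"
    using has_derivative_imp_directional(1)[OF assms(1-5)] .
  show "\<forall>\<^sub>F t in at 0. (f (x + t *\<^sub>R v) - f x) /\<^sub>R t \<in> W"
    using has_derivative_imp_directional(2)[OF assms(1-5)]
  proof eventually_elim
    case (elim t)
    then show ?case using assms(2,6,7) by (auto intro!: subspace_scale subspace_diff)
  qed
qed simp

lemma Ck_on_imp_continuous_on: "Ck_on k V U f \<Longrightarrow> continuous_on U f"
proof (cases k)
  case (Suc k')
  assume "Ck_on k V U f"
  then obtain f' where "\<And>x. x \<in> U \<Longrightarrow> (f has_derivative f' x) (at x within U)"
    unfolding Suc Ck_on.simps by blast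
  then show ?thesis by (rule has_derivative_continuous_on)
qed simp

lemma Ck_on_SucD: "Ck_on (Suc k) V U f \<Longrightarrow> Ck_on k V U f"
proof (induction k arbitrary: f)
  case 0
  then have "continuous_on U f" by (rule Ck_on_imp_continuous_on)
  then show ?case by simp
next
  case (Suc k)
  then show ?case unfolding Ck_on.simps(2)[of k] Ck_on.simps(2)[of "Suc k"] by blast
qed

lemma Ck_on_cong:
  assumes "\<And>x. x \<in> U \<Longrightarrow> f x = g x" "Ck_on k V U f"
  shows "Ck_on k V U g"
proof (cases k)
  case 0
  then show ?thesis using assms continuous_on_cong[of U U f g] by simp
next
  case (Suc k')
  have "(g has_derivative D) (at x within U)" if "(f has_derivative D) (at x within U)" "x \<in> U" for D x
    using has_derivative_transform[OF that(2) _ that(1)] assms(1) by simp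
  then show ?thesis using assms(2) unfolding Suc Ck_on.simps by blast
qed

lemma Ck_on_const: "Ck_on k V U (\<lambda>x. c)"
proof (induction k arbitrary: c)
  case (Suc k)
  show ?case unfolding Ck_on.simps
    by (rule exI[of _ "\<lambda>_ _. 0"]) (auto simp: Suc)
qed simp

lemma Ck_on_linear: "bounded_linear f \<Longrightarrow> Ck_on k V U f"
proof (cases k)
  case (Suc k')
  assume "bounded_linear f"
  then show ?thesis unfolding Suc Ck_on.simps
    by (intro exI[of _ "\<lambda>_. f"]) (auto simp: Ck_on_const bounded_linear_imp_has_derivative)
qed (simp add: linear_continuous_on)

lemma Ck_on_linear_compose:
  assumes "bounded_linear h" "Ck_on k V U f"
  shows "Ck_on k V U (\<lambda>x. h (f x))"
  using assms(2)
proof (induction k arbitrary: f)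
  case 0
  then show ?case using bounded_linear.continuous_on[OF assms(1)] by simp
next
  case (Suc k)
  then obtain f' where "\<And>x. x \<in> U \<Longrightarrow> (f has_derivative f' x) (at x within U)"
    "\<And>v. v \<in> V \<Longrightarrow> Ck_on k V U (\<lambda>x. f' x v)"
    by auto
  then show ?case
    by (auto intro!: exI[of _ "\<lambda>x v. h (f' x v)"] bounded_linear.has_derivative[OF assms(1)] Suc.IH)
qed

lemma Ck_on_add:
  assumes "Ck_on k V U f" "Ck_on k V U g"
  shows "Ck_on k V U (\<lambda>x. f x + g x)"
  using assms
proof (induction k arbitrary: f g)
  case 0
  then show ?case by (auto intro: continuous_on_add)
next
  case (Suc k)
  obtain f' where f': "\<And>x. x \<in> U \<Longrightarrow> (f has_derivative f' x) (at x within U)"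
    "\<And>v. v \<in> V \<Longrightarrow> Ck_on k V U (\<lambda>x. f' x v)"
    using Suc.prems(1) by auto
  obtain g' where g': "\<And>x. x \<in> U \<Longrightarrow> (g has_derivative g' x) (at x within U)"
    "\<And>v. v \<in> V \<Longrightarrow> Ck_on k V U (\<lambda>x. g' x v)"
    using Suc.prems(2) by auto
  show ?case unfolding Ck_on.simps
    using f' g' by (intro exI[of _ "\<lambda>x v. f' x v + g' x v"]) (auto intro!: Suc.IH has_derivative_add)
qed

lemma Ck_on_sum:
  assumes "\<And>i. i \<in> I \<Longrightarrow> Ck_on k V U (f i)"
  shows "Ck_on k V U (\<lambda>x. \<Sum>i\<in>I. f i x)"
  using assms
  by (induction I rule: infinite_finite_induct) (auto intro: Ck_on_const Ck_on_add)

lemma Ck_on_bilinear: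
  assumes "bounded_bilinear m" "Ck_on k V U f" "Ck_on k V U g"
  shows "Ck_on k V U (\<lambda>x. m (f x) (g x))"
  using assms(2,3)
proof (induction k arbitrary: f g)
  case 0
  then show ?case using bounded_bilinear.continuous_on[OF assms(1)] by auto
next
  case (Suc k)
  obtain f' where f': "\<And>x. x \<in> U \<Longrightarrow> (f has_derivative f' x) (at x within U)"
    "\<And>v. v \<in> V \<Longrightarrow> Ck_on k V U (\<lambda>x. f' x v)"
    using Suc.prems(1) by auto
  obtain g' where g': "\<And>x. x \<in> U \<Longrightarrow> (g has_derivative g' x) (at x within U)"
    "\<And>v. v \<in> V \<Longrightarrow> Ck_on k V U (\<lambda>x. g' x v)"
    using Suc.prems(2) by auto
  have "Ck_on k V U f" "Ck_on k V U g" by (rule Suc.prems[THEN Ck_on_SucD])+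
  then have "Ck_on k V U (\<lambda>x. m (f x) (g' x v) + m (f' x v) (g x))" if "v \<in> V" for v
    using f'(2)[OF that] g'(2)[OF that] by (intro Suc.IH Ck_on_add)
  moreover have "((\<lambda>x. m (f x) (g x)) has_derivative (\<lambda>v. m (f x) (g' x v) + m (f' x v) (g x)))
      (at x within U)" if "x \<in> U" for x
    using f'(1)[OF that] g'(1)[OF that] by (rule bounded_bilinear.FDERIV[OF assms(1)])
  ultimately show ?case unfolding Ck_on.simps
    by (intro exI[of _ "\<lambda>x v. m (f x) (g' x v) + m (f' x v) (g x)"]) simp
qed

text \<open>Bootstrapping: the derivative is a product of \<open>f'\<close> and the inverse itself,
  so order \<open>k\<close> for the inverse yields order \<open>Suc k\<close>. The square root below
  is treated in the same way.\<close>

lemma Ck_on_inverse: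
  fixes f :: "_ \<Rightarrow> 'a::real_normed_field"
  assumes "\<And>x. x \<in> U \<Longrightarrow> f x \<noteq> 0" "Ck_on k V U f"
  shows "Ck_on k V U (\<lambda>x. inverse (f x))"
  using assms(2)
proof (induction k)
  case 0
  then show ?case using assms(1) by (auto intro: continuous_on_inverse)
next
  case (Suc k)
  then obtain f' where f': "\<And>x. x \<in> U \<Longrightarrow> (f has_derivative f' x) (at x within U)"
    "\<And>v. v \<in> V \<Longrightarrow> Ck_on k V U (\<lambda>x. f' x v)"
    by auto
  have "Ck_on k V U (\<lambda>x. inverse (f x))" by (rule Suc.IH[OF Ck_on_SucD[OF Suc.prems]])
  then have "Ck_on k V U (\<lambda>x. - (inverse (f x) * f' x v * inverse (f x)))" if "v \<in> V" for v
    using f'(2)[OF that]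
    by (intro Ck_on_linear_compose[OF bounded_linear_minus[OF bounded_linear_ident]]
        Ck_on_bilinear[OF bounded_bilinear_mult])
  then show ?case unfolding Ck_on.simps
    by (intro exI[of _ "\<lambda>x v. - (inverse (f x) * f' x v * inverse (f x))"])
      (use f'(1) assms(1) in \<open>auto intro!: Deriv.has_derivative_inverse\<close>)
qed

lemma Ck_on_sqrt:
  assumes "\<And>x. x \<in> U \<Longrightarrow> 0 < f x" "Ck_on k V U f"
  shows "Ck_on k V U (\<lambda>x. sqrt (f x))"
  using assms(2)
proof (induction k)
  case 0
  then show ?case by (auto intro: continuous_on_real_sqrt)
next
  case (Suc k)
  then obtain f' where f': "\<And>x. x \<in> U \<Longrightarrow> (f has_derivative f' x) (at x within U)"
    "\<And>v. v \<in> V \<Longrightarrow> Ck_on k V U (\<lambda>x. f' x v)"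
    by auto
  have "Ck_on k V U (\<lambda>x. sqrt (f x))" by (rule Suc.IH[OF Ck_on_SucD[OF Suc.prems]])
  then have "Ck_on k V U (\<lambda>x. f' x v * inverse (2 * sqrt (f x)))" if "v \<in> V" for v
    using assms(1)
    by (intro Ck_on_bilinear[OF bounded_bilinear_mult] f'(2) that Ck_on_inverse Ck_on_const)
      (auto simp: less_imp_neq[symmetric])
  moreover have "((\<lambda>x. sqrt (f x)) has_derivative (\<lambda>v. f' x v * inverse (2 * sqrt (f x)))) (at x within U)"
    if "x \<in> U" for x
    using assms(1)[OF that] f'(1)[OF that]
    by (auto intro!: derivative_eq_intros simp: fun_eq_iff field_simps)
  ultimately show ?case unfolding Ck_on.simps
    by (intro exI[of _ "\<lambda>x v. f' x v * inverse (2 * sqrt (f x))"]) auto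
qed

text \<open>Serves the sign function, which is discontinuous at zero but locally constant along a
  continuous function without zeros.\<close>

lemma Ck_on_locally_constant:
  assumes "\<And>x. x \<in> U \<Longrightarrow> eventually (\<lambda>y. f y = f x) (at x within U)"
  shows "Ck_on k V U f"
proof -
  have D: "(f has_derivative (\<lambda>_. 0)) (at x within U)" if "x \<in> U" for x
  proof -
    have "((\<lambda>_. f x) has_derivative (\<lambda>_. 0)) (at x within U)" by simp
    then show ?thesis
      by (rule has_derivative_transform_eventually) (use assms[OF that] that in \<open>auto simp: eq_commute\<close>)
  qed
  show ?thesis
  proof (cases k)
    case 0
    then show ?thesis using D has_derivative_continuous_on[of U f "\<lambda>_ _. 0"] by simp
  next
    case (Suc k')
    then show ?thesis using D unfolding Suc Ck_on.simps
      by (intro exI[of _ "\<lambda>_ _. 0"]) (auto simp: Ck_on_const)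
  qed
qed

lemma Ck_on_sgn:
  fixes f :: "_ \<Rightarrow> real"
  assumes "\<And>x. x \<in> U \<Longrightarrow> f x \<noteq> 0" "continuous_on U f"
  shows "Ck_on k V U (\<lambda>x. sgn (f x))"
proof (rule Ck_on_locally_constant)
  fix x assume x: "x \<in> U"
  then have lim: "(f \<longlongrightarrow> f x) (at x within U)" using assms(2) by (simp add: continuous_on_def)
  show "\<forall>\<^sub>F y in at x within U. sgn (f y) = sgn (f x)"
  proof (cases "0 < f x")
    case True
    from order_tendstoD(1)[OF lim this] show ?thesis
      by eventually_elim (use True in auto)
  next
    case False
    then have "f x < 0" using assms(1)[OF x] by simp
    from order_tendstoD(2)[OF lim this] show ?thesis
      by eventually_elim (use \<open>f x < 0\<close> in auto)
  qed
qed

lemma subspace_orthonormal_basis: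
  fixes V :: "'a::euclidean_space set"
  assumes "subspace V"
  obtains B where "finite B" "B \<subseteq> V" "\<And>v. v \<in> V \<Longrightarrow> (\<Sum>b\<in>B. (v \<bullet> b) *\<^sub>R b) = v"
proof -
  obtain B where B: "B \<subseteq> V" "pairwise orthogonal B" "\<And>x. x \<in> B \<Longrightarrow> norm x = 1"
    "independent B" "span B = V"
    using orthonormal_basis_subspace[OF assms] by metis
  have "finite B" using B(4) independent_imp_finite by blast
  with B that show ?thesis using orthonormal_basis_expand by metis
qed

text \<open>The obstacle is that in \<open>h' (f x) (f' x v)\<close> the direction varies with
  \<open>x\<close>, whereas \<open>Ck_on\<close> speaks of fixed directions. Expanding
  \<open>f' x v\<close> in an orthonormal basis of \<open>W\<close> leaves finitely many products of
  a coordinate of \<open>f'\<close> with \<open>h'\<close> in a basis direction, and the induction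
  hypothesis applies to the latter.\<close>

lemma Ck_on_compose:
  fixes f :: "'a::real_normed_vector \<Rightarrow> 'b::euclidean_space"
  assumes "subspace V" "openin (top_of_set V) U" "subspace W" "U' \<subseteq> W" "f ` U \<subseteq> U'"
    and "Ck_on k V U f" "Ck_on k W U' h"
  shows "Ck_on k V U (\<lambda>x. h (f x))"
  using assms(6,7)
proof (induction k arbitrary: h)
  case 0
  then show ?case using continuous_on_compose2[OF _ _ assms(5)] by auto
next
  case (Suc k)
  obtain f' where f': "\<And>x. x \<in> U \<Longrightarrow> (f has_derivative f' x) (at x within U)"
    "\<And>v. v \<in> V \<Longrightarrow> Ck_on k V U (\<lambda>x. f' x v)"
    using Suc.prems(1) by auto
  obtain h' where h': "\<And>x. x \<in> U' \<Longrightarrow> (h has_derivative h' x) (at x within U')"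
    "\<And>v. v \<in> W \<Longrightarrow> Ck_on k W U' (\<lambda>x. h' x v)"
    using Suc.prems(2) by auto
  obtain B where B: "finite B" "B \<subseteq> W" "\<And>v. v \<in> W \<Longrightarrow> (\<Sum>b\<in>B. (v \<bullet> b) *\<^sub>R b) = v"
    using subspace_orthonormal_basis[OF assms(3)] by blast
  have W: "f' x v \<in> W" if "x \<in> U" "v \<in> V" for x v
    using has_derivative_in_subspace[OF f'(1)[OF that(1)] that assms(2,1)] assms(3,4,5)
      closed_subspace by blast
  have D: "((\<lambda>x. h (f x)) has_derivative (\<lambda>v. h' (f x) (f' x v))) (at x within U)" if "x \<in> U" for x
  proof (rule has_derivative_in_compose[OF f'(1)[OF that]])
    show "(h has_derivative h' (f x)) (at (f x) within f ` U)"
      using h'(1) assms(5) that by (blast intro: has_derivative_subset)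
  qed
  have C: "Ck_on k V U (\<lambda>x. h' (f x) (f' x v))" if "v \<in> V" for v
  proof (rule Ck_on_cong)
    fix x assume x: "x \<in> U"
    then have "linear (h' (f x))" using h'(1) has_derivative_linear assms(5) by blast
    then have "(\<Sum>b\<in>B. (f' x v \<bullet> b) *\<^sub>R h' (f x) b) = h' (f x) (\<Sum>b\<in>B. (f' x v \<bullet> b) *\<^sub>R b)"
      by (simp add: linear_sum linear_cmul)
    then show "(\<Sum>b\<in>B. (f' x v \<bullet> b) *\<^sub>R h' (f x) b) = h' (f x) (f' x v)"
      using B(3) W[OF x that] by simp
  next
    have "Ck_on k V U f" by (rule Ck_on_SucD[OF Suc.prems(1)])
    then show "Ck_on k V U (\<lambda>x. \<Sum>b\<in>B. (f' x v \<bullet> b) *\<^sub>R h' (f x) b)"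
      using B(2) h'(2) f'(2)[OF that]
      by (intro Ck_on_sum Ck_on_bilinear[OF bounded_bilinear_scaleR] Suc.IH
          Ck_on_linear_compose[OF bounded_linear_inner_left]) auto
  qed
  show ?case unfolding Ck_on.simps
    by (intro exI[of _ "\<lambda>x v. h' (f x) (f' x v)"]) (auto simp: D C)
qed

lemma smooth_on_imp_continuous_on: "smooth_on V U f \<Longrightarrow> continuous_on U f"
  unfolding smooth_on_def by (rule Ck_on_imp_continuous_on, erule spec)

lemma smooth_on_cong:
  assumes "\<And>x. x \<in> U \<Longrightarrow> f x = g x" "smooth_on V U f"
  shows "smooth_on V U g"
  using assms(2) unfolding smooth_on_def by (intro allI Ck_on_cong[OF assms(1)]) (auto elim: spec)

lemma smooth_on_const [simp]: "smooth_on V U (\<lambda>x. c)"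
  by (simp add: smooth_on_def Ck_on_const del: Ck_on.simps)

lemma smooth_on_linear: "bounded_linear f \<Longrightarrow> smooth_on V U f"
  by (simp add: smooth_on_def Ck_on_linear del: Ck_on.simps)

lemma smooth_on_linear_compose:
  "bounded_linear h \<Longrightarrow> smooth_on V U f \<Longrightarrow> smooth_on V U (\<lambda>x. h (f x))"
  unfolding smooth_on_def by (rule allI, rule Ck_on_linear_compose; (assumption | erule spec))

lemma smooth_on_add: "smooth_on V U f \<Longrightarrow> smooth_on V U g \<Longrightarrow> smooth_on V U (\<lambda>x. f x + g x)"
  unfolding smooth_on_def by (rule allI, rule Ck_on_add; erule spec)

lemma smooth_on_diff:
  assumes "smooth_on V U f" "smooth_on V U g"
  shows "smooth_on V U (\<lambda>x. f x - g x)"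
proof -
  have "smooth_on V U (\<lambda>x. f x + - g x)"
    by (rule smooth_on_add[OF assms(1)
          smooth_on_linear_compose[OF bounded_linear_minus[OF bounded_linear_ident] assms(2)]])
  then show ?thesis by simp
qed

lemma smooth_on_sum:
  "(\<And>i. i \<in> I \<Longrightarrow> smooth_on V U (f i)) \<Longrightarrow> smooth_on V U (\<lambda>x. \<Sum>i\<in>I. f i x)"
  unfolding smooth_on_def by (rule allI, rule Ck_on_sum) blast

lemma smooth_on_mult:
  fixes f g :: "_ \<Rightarrow> 'a::real_normed_algebra"
  shows "smooth_on V U f \<Longrightarrow> smooth_on V U g \<Longrightarrow> smooth_on V U (\<lambda>x. f x * g x)"
  unfolding smooth_on_def by (rule allI, rule Ck_on_bilinear[OF bounded_bilinear_mult]; erule spec)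

lemma smooth_on_inverse:
  fixes f :: "_ \<Rightarrow> 'a::real_normed_field"
  shows "smooth_on V U f \<Longrightarrow> (\<And>x. x \<in> U \<Longrightarrow> f x \<noteq> 0) \<Longrightarrow> smooth_on V U (\<lambda>x. inverse (f x))"
  unfolding smooth_on_def by (rule allI, rule Ck_on_inverse) blast+

lemma smooth_on_sqrt:
  "smooth_on V U f \<Longrightarrow> (\<And>x. x \<in> U \<Longrightarrow> 0 < f x) \<Longrightarrow> smooth_on V U (\<lambda>x. sqrt (f x))"
  unfolding smooth_on_def by (rule allI, rule Ck_on_sqrt) blast+

lemma smooth_on_sgn:
  fixes f :: "_ \<Rightarrow> real"
  assumes "smooth_on V U f" "\<And>x. x \<in> U \<Longrightarrow> f x \<noteq> 0"
  shows "smooth_on V U (\<lambda>x. sgn (f x))"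
  unfolding smooth_on_def
  by (rule allI, rule Ck_on_sgn[OF assms(2) smooth_on_imp_continuous_on[OF assms(1)]])

lemma smooth_on_abs:
  fixes f :: "_ \<Rightarrow> real"
  assumes "smooth_on V U f" "\<And>x. x \<in> U \<Longrightarrow> f x \<noteq> 0"
  shows "smooth_on V U (\<lambda>x. \<bar>f x\<bar>)"
  using smooth_on_mult[OF assms(1) smooth_on_sgn[OF assms]] by (simp only: abs_sgn)

lemma smooth_on_compose:
  fixes f :: "'a::real_normed_vector \<Rightarrow> 'b::euclidean_space"
  assumes "smooth_on V U f" "smooth_on W U' h" "f ` U \<subseteq> U'"
    and "subspace V" "openin (top_of_set V) U" "subspace W" "U' \<subseteq> W"
  shows "smooth_on V U (\<lambda>x. h (f x))"
  unfolding smooth_on_def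
proof
  fix k
  show "Ck_on k V U (\<lambda>x. h (f x))"
    using assms(1,2) unfolding smooth_on_def
    by (blast intro: Ck_on_compose[OF assms(4,5,6,7,3), of k h])
qed

lemma smooth_on_imp_has_derivative:
  assumes "smooth_on V U f"
  obtains f' where "\<And>x. x \<in> U \<Longrightarrow> (f has_derivative f' x) (at x within U)"
proof -
  have "Ck_on (Suc 0) V U f" using assms unfolding smooth_on_def by blast
  then show ?thesis using that by auto
qed

text \<open>For each order, \<open>Ck_on\<close> provides a derivative of its own; uniqueness on
  \<open>V\<close> identifies all of them with the given \<open>f'\<close>.\<close>

lemma smooth_on_derivative:
  assumes "smooth_on V U f" "\<And>x. x \<in> U \<Longrightarrow> (f has_derivative f' x) (at x within U)"
    and "v \<in> V" "openin (top_of_set V) U" "subspace V"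
  shows "smooth_on V U (\<lambda>x. f' x v)"
  unfolding smooth_on_def
proof
  fix k
  have "Ck_on (Suc k) V U f" using assms(1) unfolding smooth_on_def by blast
  then obtain f'' where f'': "\<And>x. x \<in> U \<Longrightarrow> (f has_derivative f'' x) (at x within U)"
    "\<And>v. v \<in> V \<Longrightarrow> Ck_on k V U (\<lambda>x. f'' x v)"
    unfolding Ck_on.simps by blast
  show "Ck_on k V U (\<lambda>x. f' x v)"
  proof (rule Ck_on_cong[OF _ f''(2)[OF assms(3)]])
    fix x assume "x \<in> U"
    then show "f'' x v = f' x v"
      by (intro has_derivative_unique_on_subspace[OF f''(1) assms(2) _ assms(3-5)])
  qed
qed

section \<open>Smoothness of vector-valued and pair-valued maps by components\<close>

lemma bounded_linear_axis: "bounded_linear (axis i :: 'a::real_normed_vector \<Rightarrow> 'a^'n)"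
proof (rule bounded_linear_intro[where K = 1])
  fix x :: 'a
  have "norm (axis i x :: 'a^'n) \<le> (\<Sum>j\<in>UNIV. norm ((axis i x :: 'a^'n) $ j))"
    unfolding norm_vec_def by (rule L2_set_le_sum) simp
  also have "\<dots> = (\<Sum>j\<in>UNIV. if j = i then norm x else 0)"
    by (intro sum.cong) (auto simp: axis_def)
  finally show "norm (axis i x :: 'a^'n) \<le> norm x * 1" by simp
qed (simp_all add: axis_def vec_eq_iff)

lemma smooth_on_vec:
  fixes f :: "_ \<Rightarrow> 'a::real_normed_vector^'n"
  assumes "\<And>i. smooth_on V U (\<lambda>x. f x $ i)"
  shows "smooth_on V U f"
proof -
  have "smooth_on V U (\<lambda>x. \<Sum>i\<in>UNIV. axis i (f x $ i))"
    by (intro smooth_on_sum smooth_on_linear_compose[OF bounded_linear_axis] assms)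
  moreover have "(\<lambda>x. \<Sum>i\<in>UNIV. axis i (f x $ i)) = f"
    by (auto simp: fun_eq_iff vec_eq_iff axis_def if_distrib cong: if_cong)
  ultimately show ?thesis by simp
qed

lemma smooth_on_vec_nth:
  fixes f :: "_ \<Rightarrow> 'a::real_normed_vector^'n"
  shows "smooth_on V U f \<Longrightarrow> smooth_on V U (\<lambda>x. f x $ i)"
  by (rule smooth_on_linear_compose[OF bounded_linear_vec_nth])

lemma smooth_on_Pair:
  assumes "smooth_on V U f" "smooth_on V U g"
  shows "smooth_on V U (\<lambda>x. (f x, g x))"
proof -
  have "smooth_on V U (\<lambda>x. (f x, 0) + (0, g x))"
    using assms
    by (intro smooth_on_add smooth_on_linear_compose[of "\<lambda>a. (a, 0)"]
        smooth_on_linear_compose[of "\<lambda>a. (0, a)"])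
      (auto intro!: bounded_linear_intros)
  then show ?thesis by simp
qed

section \<open>Real and complex scalars\<close>

text \<open>The axioms use \<open>r *\<^sub>R 1\<close> because \<open>of_real\<close> is not available in a class specification.\<close>

class rc_field = conjugatable_ordered_field + real_normed_field + euclidean_space +
  assumes conjugate_scaleR_1: "conjugate (r *\<^sub>R 1) = r *\<^sub>R 1"
    and conjugate_mult_scaleR_1: "conjugate x * x = (norm x ^ 2) *\<^sub>R 1"
    and zero_less_iff_scaleR_1: "0 < x \<longleftrightarrow> (\<exists>r>0. x = r *\<^sub>R 1)"
    and add_conjugate_scaleR_1: "x + conjugate x = (2 * (x \<bullet> 1)) *\<^sub>R 1"

instance real :: rc_field
  by standard (auto simp: power2_eq_square)

instance complex :: rc_field
proof
  fix x :: complex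
  show "conjugate x * x = (norm x ^ 2) *\<^sub>R 1"
    using complex_norm_square[of x] by (simp add: mult.commute scaleR_conv_of_real)
  show "0 < x \<longleftrightarrow> (\<exists>r>0. x = r *\<^sub>R 1)"
    by (auto simp: less_complex_def complex_eq_iff intro!: exI[of _ "Re x"])
  show "x + conjugate x = (2 * (x \<bullet> 1)) *\<^sub>R 1"
    by (simp add: complex_eq_iff inner_complex_def)
qed simp

lemma
  shows conjugate_of_real: "conjugate (of_real r) = (of_real r :: 'k::rc_field)"
    and conjugate_mult_self: "conjugate x * x = (of_real ((norm x)\<^sup>2) :: 'k)"
    and zero_less_iff_of_real: "0 < x \<longleftrightarrow> (\<exists>r>0. x = (of_real r :: 'k))"
    and add_conjugate: "x + conjugate x = (of_real (2 * re x) :: 'k)"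
  unfolding of_real_def re_def
  by (fact conjugate_scaleR_1 conjugate_mult_scaleR_1 zero_less_iff_scaleR_1 add_conjugate_scaleR_1)+

lemma re_of_real [simp]: "re (of_real r :: 'k::rc_field) = r"
  by (simp add: re_def of_real_def flip: power2_norm_eq_inner)

lemma re_0 [simp]: "re (0 :: 'k::rc_field) = 0" and re_1 [simp]: "re (1 :: 'k::rc_field) = 1"
  using re_of_real[of 0, where 'k = 'k] re_of_real[of 1, where 'k = 'k] by simp_all

lemma re_add: "re (x + y) = re x + re y"
  by (simp add: re_def inner_left_distrib)

lemma re_minus: "re (- x) = - re x"
  by (simp add: re_def)

lemma re_scaleR: "re (c *\<^sub>R x) = c * re x"
  by (simp add: re_def)

lemma bounded_linear_re: "bounded_linear re"
  unfolding re_def by (rule bounded_linear_inner_left)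

lemma re_sum: "re (\<Sum>i\<in>I. f i) = (\<Sum>i\<in>I. re (f i))"
  by (simp add: re_def inner_sum_left)

lemma norm_conjugate [simp]: "norm (conjugate x) = norm (x :: 'k::rc_field)"
proof (cases "x = 0")
  case False
  have "norm (conjugate x * x) = (norm x)\<^sup>2"
    unfolding conjugate_mult_self norm_of_real by simp
  then have "norm (conjugate x) * norm x = norm x * norm x"
    by (simp add: norm_mult power2_eq_square)
  then show ?thesis using False by simp
qed simp

lemma bounded_linear_conjugate: "bounded_linear (conjugate :: 'k::rc_field \<Rightarrow> 'k)"
  by (rule bounded_linear_intro[where K = 1])
    (simp_all add: conjugate_dist_add scaleR_conv_of_real conjugate_dist_mul conjugate_of_real)

lemma re_conjugate [simp]: "re (conjugate x) = re (x :: 'k::rc_field)"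
proof -
  have "(of_real (2 * re (conjugate x)) :: 'k) = of_real (2 * re x)"
    unfolding add_conjugate[symmetric] by (simp add: add.commute)
  then show ?thesis by simp
qed

lemma conjugate_fixed_iff: "conjugate x = x \<longleftrightarrow> x = of_real (re (x :: 'k::rc_field))"
proof
  assume c: "conjugate x = x"
  have "2 * x = 2 * of_real (re x)"
    using add_conjugate[of x] unfolding c mult_2[symmetric] of_real_mult of_real_numeral .
  then show "x = of_real (re x)" by (rule iffD1[OF mult_left_cancel, rotated]) simp
next
  assume e: "x = of_real (re x)"
  have "conjugate x = conjugate (of_real (re x))" by (rule arg_cong[OF e])
  also have "\<dots> = of_real (re x)" by (rule conjugate_of_real)
  also have "\<dots> = x" by (rule e[symmetric])
  finally show "conjugate x = x" .
qed

lemma Reals_eq_of_real_re: "x \<in> \<real> \<longleftrightarrow> x = of_real (re (x :: 'k::rc_field))"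
proof
  assume e: "x = of_real (re x)"
  have "of_real (re x) \<in> (\<real> :: 'k set)" by simp
  then show "x \<in> \<real>" by (simp only: e[symmetric])
qed (auto elim!: Reals_cases)

lemma zero_less_iff_re: "0 < x \<longleftrightarrow> x \<in> \<real> \<and> 0 < re (x :: 'k::rc_field)"
  unfolding zero_less_iff_of_real[of x] by (auto elim!: Reals_cases)

lemma re_conjugate_mult_commute: "re (conjugate x * y) = re (conjugate y * (x :: 'k::rc_field))"
  using re_conjugate[of "conjugate x * y"] by (simp add: conjugate_dist_mul mult.commute)

lemma re_conjugate_mult_self: "re (conjugate x * x) = (norm (x :: 'k::rc_field))\<^sup>2"
  unfolding conjugate_mult_self re_of_real ..

lemma conjugate_scaleR: "conjugate (c *\<^sub>R x) = c *\<^sub>R conjugate (x :: 'k::rc_field)"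
  by (rule linear_cmul[OF bounded_linear.linear[OF bounded_linear_conjugate]])

lemma subspace_hermitian: "subspace (hermitian :: ('k::rc_field, 'n::finite) sqmat set)"
  by (auto simp: subspace_def hermitian_def conj_transpose_def vec_eq_iff conjugate_dist_add conjugate_scaleR)

lemma hermitianD: "A \<in> hermitian \<Longrightarrow> conjugate (A $ i $ j) = A $ j $ i"
  unfolding hermitian_def conj_transpose_def by (auto simp: vec_eq_iff)

lemma subspace_lower_tangent: "subspace (lower_tangent :: ('k::rc_field, 'n::{finite,linorder}) sqmat set)"
proof -
  have "c *\<^sub>R x \<in> \<real>" if "x \<in> \<real>" for c and x :: 'k
    using that by (simp add: scaleR_conv_of_real)
  then show ?thesis by (auto simp: subspace_def lower_tangent_def)
qed

section \<open>The group of lower triangular matrices with nonzero real diagonal\<close>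

text \<open>The model for the whole cone: an open subset of the real vector space
  \<open>lower_tangent\<close>, whose components are the sign patterns of the diagonal.\<close>

definition lower_nz :: "('k::real_normed_field, 'n::{finite,linorder}) sqmat set"
  where "lower_nz = {L \<in> lower_tangent. \<forall>j. L $ j $ j \<noteq> 0}"

lemma lower_pos_eq:
  "(lower_pos :: ('k::rc_field, 'n::{finite,linorder}) sqmat set)
    = {L \<in> lower_tangent. \<forall>j. 0 < re (L $ j $ j)}"
  by (auto simp: lower_pos_def lower_tangent_def zero_less_iff_re[where 'k = 'k])

lemma lower_pos_subset_lower_nz:
  "(lower_pos :: ('k::rc_field, 'n::{finite,linorder}) sqmat set) \<subseteq> lower_nz"
  by (auto simp: lower_pos_eq lower_nz_def) (metis less_irrefl re_0)

lemma lower_nz_subset_lower_tangent: "lower_nz \<subseteq> lower_tangent"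
  by (auto simp: lower_nz_def)

lemma lower_tangent_upper: "L \<in> lower_tangent \<Longrightarrow> i < j \<Longrightarrow> L $ i $ j = 0"
  by (simp add: lower_tangent_def)

lemma lower_tangent_diag: "L \<in> lower_tangent \<Longrightarrow> L $ j $ j = of_real (re (L $ j $ j :: 'k::rc_field))"
  by (rule iffD1[OF Reals_eq_of_real_re]) (simp add: lower_tangent_def)

lemma lower_nz_re_nz: "L \<in> lower_nz \<Longrightarrow> re (L $ j $ j :: 'k::rc_field) \<noteq> 0"
proof
  assume "L \<in> lower_nz" "re (L $ j $ j) = 0"
  then show False using lower_tangent_diag[of L j] by (simp add: lower_nz_def)
qed

lemma openin_lower_nz:
  "openin (top_of_set lower_tangent) (lower_nz :: ('k::rc_field, 'n::{finite,linorder}) sqmat set)"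
proof -
  have "open (\<Inter>j. {L :: ('k, 'n) sqmat. L $ j $ j \<noteq> 0})"
    by (intro open_INT ballI open_Collect_neq continuous_intros) simp
  moreover have "lower_nz = lower_tangent \<inter> (\<Inter>j. {L :: ('k, 'n) sqmat. L $ j $ j \<noteq> 0})"
    by (auto simp: lower_nz_def)
  ultimately show ?thesis by (auto simp: openin_open)
qed

lemma openin_lower_pos:
  "openin (top_of_set lower_tangent) (lower_pos :: ('k::rc_field, 'n::{finite,linorder}) sqmat set)"
proof -
  have "open (\<Inter>j. {L :: ('k, 'n) sqmat. 0 < re (L $ j $ j)})"
    by (intro open_INT ballI open_Collect_less continuous_intros
        bounded_linear.continuous_on[OF bounded_linear_re]) simp
  moreover have "lower_pos = lower_tangent \<inter> (\<Inter>j. {L :: ('k, 'n) sqmat. 0 < re (L $ j $ j)})"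
    by (auto simp: lower_pos_eq)
  ultimately show ?thesis by (auto simp: openin_open)
qed

lemma lower_mult_nth:
  "lower_mult L K $ i $ j =
    (if j < i then L $ i $ j + K $ i $ j else if i = j then L $ i $ i * K $ i $ i else 0)"
proof -
  have "(\<Sum>k\<in>UNIV. diag_part L $ i $ k * diag_part K $ k $ j)
      = (\<Sum>k\<in>UNIV. if k = i then (if i = j then L $ i $ i * K $ i $ i else 0) else 0)"
    by (intro sum.cong) (auto simp: diag_part_def)
  then show ?thesis
    by (auto simp: lower_mult_def strict_lower_def matrix_matrix_mult_def)
qed

definition lower_inv :: "('k::field, 'n::{finite,linorder}) sqmat \<Rightarrow> ('k, 'n) sqmat"
  where "lower_inv L =
    (\<chi> i j. if j < i then - L $ i $ j else if i = j then inverse (L $ i $ i) else 0)"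

lemma lower_mult_in_lower_nz: "L \<in> lower_nz \<Longrightarrow> K \<in> lower_nz \<Longrightarrow> lower_mult L K \<in> lower_nz"
  by (auto simp: lower_nz_def lower_tangent_def lower_mult_nth)

lemma lower_mult_in_lower_pos:
  "L \<in> lower_pos \<Longrightarrow> K \<in> lower_pos \<Longrightarrow> lower_mult L K \<in> (lower_pos :: ('k::rc_field, 'n::{finite,linorder}) sqmat set)"
proof -
  have "0 < x * y" if "0 < x" "0 < y" for x y :: 'k
    using that by (auto simp: zero_less_iff_of_real[where 'k = 'k] simp flip: of_real_mult)
  then show "L \<in> lower_pos \<Longrightarrow> K \<in> lower_pos \<Longrightarrow> lower_mult L K \<in> lower_pos"
    by (auto simp: lower_pos_def lower_mult_nth)
qed

lemma mat_1_in_lower_pos: "mat 1 \<in> (lower_pos :: ('k::rc_field, 'n::{finite,linorder}) sqmat set)"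
  by (auto simp: lower_pos_eq lower_tangent_def mat_def)

lemma lower_inv_in_lower_nz: "L \<in> lower_nz \<Longrightarrow> lower_inv L \<in> lower_nz"
  by (auto simp: lower_nz_def lower_tangent_def lower_inv_def)

lemma lower_inv_in_lower_pos:
  "L \<in> lower_pos \<Longrightarrow> lower_inv L \<in> (lower_pos :: ('k::rc_field, 'n::{finite,linorder}) sqmat set)"
proof -
  have "0 < inverse x" if "0 < x" for x :: 'k
    using that by (auto simp: zero_less_iff_of_real[where 'k = 'k] simp flip: of_real_inverse)
  then show "L \<in> lower_pos \<Longrightarrow> lower_inv L \<in> lower_pos"
    by (auto simp: lower_pos_def lower_inv_def)
qed

lemma lower_mult_assoc: "lower_mult (lower_mult L K) H = lower_mult L (lower_mult K H)"
  by (auto simp: vec_eq_iff lower_mult_nth add.assoc mult.assoc)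

lemma lower_mult_commute: "lower_mult L K = lower_mult K (L :: ('k::comm_semiring_1, 'n::{finite,linorder}) sqmat)"
  by (auto simp: vec_eq_iff lower_mult_nth add.commute mult.commute)

lemma lower_mult_1: "L \<in> lower_nz \<Longrightarrow> lower_mult (mat 1) L = L"
  by (auto simp: vec_eq_iff lower_mult_nth mat_def lower_nz_def lower_tangent_def not_less)

lemma lower_inv_mult: "L \<in> lower_nz \<Longrightarrow> lower_mult (lower_inv L) L = mat 1"
  by (auto simp: vec_eq_iff lower_mult_nth lower_inv_def mat_def lower_nz_def)

lemma smooth_on_if: "(c \<Longrightarrow> smooth_on V U f) \<Longrightarrow> (\<not> c \<Longrightarrow> smooth_on V U g)
    \<Longrightarrow> smooth_on V U (\<lambda>x. if c then f x else g x)"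
  by (cases c) auto

lemma smooth_on_id: "smooth_on V U (\<lambda>x. x)"
  by (rule smooth_on_linear[OF bounded_linear_ident])

lemma smooth_on_lower_mult:
  "smooth_on V U (\<lambda>p. lower_mult (fst p) (snd p :: ('k::real_normed_field, 'n::{finite,linorder}) sqmat))"
proof -
  have e: "smooth_on V U (\<lambda>p. fst p $ i $ j)" "smooth_on V U (\<lambda>p. snd p $ i $ j)"
    for i j :: 'n and V U :: "(('k, 'n) sqmat \<times> ('k, 'n) sqmat) set"
    by (intro smooth_on_vec_nth smooth_on_linear bounded_linear_fst bounded_linear_snd)+
  show ?thesis
    by (intro smooth_on_vec) (simp only: lower_mult_nth, intro smooth_on_if smooth_on_add smooth_on_mult e smooth_on_const)
qed

lemma smooth_on_lower_inv:
  "smooth_on V lower_nz (lower_inv :: ('k::real_normed_field, 'n::{finite,linorder}) sqmat \<Rightarrow> _)"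
proof -
  have e: "smooth_on V lower_nz (\<lambda>L :: ('k, 'n) sqmat. L $ i $ j)" for i j
    by (intro smooth_on_vec_nth smooth_on_id)
  show ?thesis
  proof (intro smooth_on_vec)
    fix i j
    have "smooth_on V lower_nz (\<lambda>L :: ('k, 'n) sqmat.
        if j < i then 0 - L $ i $ j else if i = j then inverse (L $ i $ i) else 0)"
      by (intro smooth_on_if smooth_on_diff smooth_on_inverse e smooth_on_const) (auto simp: lower_nz_def)
    then show "smooth_on V lower_nz (\<lambda>L :: ('k, 'n) sqmat. lower_inv L $ i $ j)"
      by (simp add: lower_inv_def cong: if_cong)
  qed
qed

text \<open>Translation by \<open>K\<close> is affine in the other argument; this is its linear
  part, and hence its derivative at every point.\<close>

definition lower_mult_deriv ::
  "('k::rc_field, 'n::{finite,linorder}) sqmat \<Rightarrow> ('k, 'n) sqmat \<Rightarrow> ('k, 'n) sqmat"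
  where "lower_mult_deriv K Y = strict_lower Y + diag_part K ** diag_part Y"

lemma lower_mult_deriv_nth:
  "lower_mult_deriv K Y $ i $ j = (if j < i then Y $ i $ j else if i = j then K $ i $ i * Y $ i $ i else 0)"
  using lower_mult_nth[of K Y i j]
  by (auto simp: lower_mult_deriv_def lower_mult_def strict_lower_def split: if_splits)

lemma has_derivative_lower_mult:
  "(lower_mult K has_derivative lower_mult_deriv (K :: ('k::rc_field, 'n::{finite,linorder}) sqmat)) (at L within U)"
proof -
  have "linear (lower_mult_deriv K)"
    by (rule linearI) (auto simp: vec_eq_iff lower_mult_deriv_nth distrib_left)
  then have "(lower_mult_deriv K has_derivative lower_mult_deriv K) (at L within U)"
    by (rule linear_imp_has_derivative)
  then have "((\<lambda>Y. strict_lower K + lower_mult_deriv K Y) has_derivative (\<lambda>Y. 0 + lower_mult_deriv K Y))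
      (at L within U)"
    by (rule has_derivative_add[OF has_derivative_const])
  moreover have "lower_mult K = (\<lambda>Y. strict_lower K + lower_mult_deriv K Y)"
    by (rule ext) (simp add: lower_mult_def lower_mult_deriv_def add.assoc)
  ultimately show ?thesis by simp
qed

lemma re_mult_Reals: "x \<in> \<real> \<Longrightarrow> re (x * y) = re x * re (y :: 'k::rc_field)"
  by (auto elim!: Reals_cases simp: re_scaleR simp flip: scaleR_conv_of_real)

section \<open>A complete bi-invariant distance on the triangular matrices\<close>

text \<open>\<open>F\<close> is a homeomorphism onto its image with inverse \<open>G\<close>, which
  gives the topology. A Cauchy sequence has a Cauchy image, whose limit stays in the image by
  closedness and can be pulled back.\<close>

lemma pullback_metric:
  fixes F :: "'a::topological_space \<Rightarrow> 'b::complete_space"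
  assumes F: "continuous_on M F" and G: "continuous_on (F ` M) G"
    and GF: "\<And>x. x \<in> M \<Longrightarrow> G (F x) = x" and cl: "closed (F ` M)"
  shows "Metric_space M (\<lambda>x y. dist (F x) (F y))"
    and "Metric_space.mtopology M (\<lambda>x y. dist (F x) (F y)) = top_of_set M"
    and "Metric_space.mcomplete M (\<lambda>x y. dist (F x) (F y))"
proof -
  have inj: "F x = F y \<longleftrightarrow> x = y" if "x \<in> M" "y \<in> M" for x y
    using GF[OF that(1)] GF[OF that(2)] by metis
  interpret Metric_space M "\<lambda>x y. dist (F x) (F y)"
  proof (rule Metric_space.intro)
    show "dist (F x) (F y) = dist (F y) (F x)" for x y by (rule dist_commute)
    show "dist (F x) (F z) \<le> dist (F x) (F y) + dist (F y) (F z)" for x y z by (rule dist_triangle)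
  qed (use inj in simp_all)
  show "Metric_space M (\<lambda>x y. dist (F x) (F y))" by unfold_locales
  have ball: "mball x r = M \<inter> F -` ball (F x) r" if "x \<in> M" for x r
    using that by (auto simp: mball_def)
  show "mtopology = top_of_set M"
    unfolding topology_eq
  proof (intro allI iffI)
    fix S assume S: "openin mtopology S"
    show "openin (top_of_set M) S"
    proof (subst openin_subopen, intro ballI)
      fix x assume x: "x \<in> S"
      then obtain r where r: "r > 0" "mball x r \<subseteq> S"
        using S unfolding openin_mtopology by blast
      have "x \<in> M" using S x unfolding openin_mtopology by blast
      then have "openin (top_of_set M) (mball x r)"
        unfolding ball[OF \<open>x \<in> M\<close>] by (intro continuous_openin_preimage_gen F open_ball)
      moreover have "x \<in> mball x r" using \<open>x \<in> M\<close> r by simp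
      ultimately show "\<exists>T. openin (top_of_set M) T \<and> x \<in> T \<and> T \<subseteq> S" using r by blast
    qed
  next
    fix S assume "openin (top_of_set M) S"
    then obtain T where T: "open T" "S = M \<inter> T" by (auto simp: openin_open)
    show "openin mtopology S"
      unfolding openin_mtopology
    proof (intro conjI allI impI)
      fix x assume x: "x \<in> S"
      \<comment> \<open>This direction needs the continuity of the inverse: a ball around
        \<open>F x\<close> inside the preimage of \<open>T\<close> under \<open>G\<close> pulls back
        to a metric ball inside \<open>S\<close>.\<close>
      have "openin (top_of_set (F ` M)) (F ` M \<inter> G -` T)"
        by (intro continuous_openin_preimage_gen G T)
      moreover have "F x \<in> F ` M \<inter> G -` T" using x T(2) GF[of x] by simp
      ultimately obtain e where e: "e > 0" "ball (F x) e \<inter> F ` M \<subseteq> F ` M \<inter> G -` T"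
        unfolding openin_contains_ball by blast
      have "y \<in> S" if "y \<in> mball x e" for y
      proof -
        have y: "y \<in> M" "F y \<in> ball (F x) e" using that by (simp_all add: mball_def)
        then have "F y \<in> F ` M \<inter> G -` T" using e(2) by blast
        then have "y \<in> T" using GF[OF y(1)] by simp
        then show ?thesis using T(2) y(1) by blast
      qed
      then show "\<exists>r>0. mball x r \<subseteq> S" using e(1) by blast
    next
      show "S \<subseteq> M" using T(2) by blast
    qed
  qed
  show mcomplete
    unfolding mcomplete_def
  proof (intro allI impI)
    fix \<sigma> assume \<sigma>: "MCauchy \<sigma>"
    have "Cauchy (\<lambda>n. F (\<sigma> n))"
    proof (rule metric_CauchyI)
      fix e :: real assume "0 < e"
      then obtain N where "\<And>n n'. N \<le> n \<Longrightarrow> N \<le> n' \<Longrightarrow> dist (F (\<sigma> n)) (F (\<sigma> n')) < e"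
        using \<sigma> unfolding MCauchy_def by metis
      then show "\<exists>N. \<forall>m\<ge>N. \<forall>n\<ge>N. dist (F (\<sigma> m)) (F (\<sigma> n)) < e" by auto
    qed
    then obtain l where l: "(\<lambda>n. F (\<sigma> n)) \<longlonglongrightarrow> l"
      using Cauchy_convergent convergent_def by blast
    have rng: "\<sigma> n \<in> M" for n using \<sigma> unfolding MCauchy_def by auto
    have "l \<in> F ` M" by (rule closed_sequentially[OF cl _ l]) (use rng in auto)
    then obtain x where x: "x \<in> M" "l = F x" by blast
    have "limitin mtopology \<sigma> x sequentially"
      using l rng x(1) unfolding limitin_metric tendsto_iff x(2) by simp
    then show "\<exists>x. limitin mtopology \<sigma> x sequentially" by blast
  qed
qed

text \<open>The first component turns \<open>lower_dist\<close> into a Euclidean distance but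
  forgets the signs. The second restores injectivity, puts different sign patterns at distance at
  least 2, and contributes nothing between matrices with equal signs.\<close>

definition lower_chart :: "('k::rc_field, 'n::{finite,linorder}) sqmat \<Rightarrow> ('k, 'n) sqmat \<times> (real, 'n) vec"
  where "lower_chart L =
    ((\<chi> i j. if j < i then L $ i $ j else if i = j then of_real (ln \<bar>re (L $ i $ i)\<bar>) else 0),
     (\<chi> j. sgn (re (L $ j $ j))))"

definition lower_unchart :: "('k::rc_field, 'n::{finite,linorder}) sqmat \<times> (real, 'n) vec \<Rightarrow> ('k, 'n) sqmat"
  where "lower_unchart = (\<lambda>(X, s).
    \<chi> i j. if j < i then X $ i $ j else if i = j then of_real (s $ i * exp (re (X $ i $ i))) else 0)"

lemma lower_unchart_chart:
  assumes "L \<in> lower_nz"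
  shows "lower_unchart (lower_chart L) = L"
proof -
  have "of_real (sgn (re (L $ i $ i)) * exp (ln \<bar>re (L $ i $ i)\<bar>)) = L $ i $ i" for i
  proof -
    have "sgn (re (L $ i $ i)) * exp (ln \<bar>re (L $ i $ i)\<bar>) = re (L $ i $ i)"
      using lower_nz_re_nz[OF assms] by (simp add: sgn_mult_abs)
    then show ?thesis
      using assms lower_tangent_diag[of L i, symmetric] by (simp add: lower_nz_def)
  qed
  moreover have "L $ i $ j = 0" if "i < j" for i j
    using assms that by (simp add: lower_nz_def lower_tangent_def)
  ultimately show ?thesis
    by (auto simp: lower_unchart_def lower_chart_def vec_eq_iff not_less_iff_gr_or_eq)
qed

text \<open>The logarithm of an absolute value takes every real value for each choice of sign, so
  the image is a subspace times a finite set. This makes it closed.\<close>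

lemma lower_chart_image:
  "lower_chart ` (lower_nz :: ('k::rc_field, 'n::{finite,linorder}) sqmat set)
    = lower_tangent \<times> {s. \<forall>j. s $ j = 1 \<or> s $ j = -1}"
proof (intro equalityI subsetI)
  fix p assume "p \<in> lower_chart ` (lower_nz :: ('k, 'n) sqmat set)"
  then obtain L :: "('k, 'n) sqmat" where L: "L \<in> lower_nz" "p = lower_chart L" by blast
  then have "sgn (re (L $ j $ j)) = 1 \<or> sgn (re (L $ j $ j)) = - 1" for j
    using lower_nz_re_nz[of L j] by (simp add: sgn_if)
  then show "p \<in> lower_tangent \<times> {s. \<forall>j. s $ j = 1 \<or> s $ j = -1}"
    by (simp add: L(2) lower_chart_def lower_tangent_def less_not_sym)
next
  fix p assume "p \<in> (lower_tangent :: ('k, 'n) sqmat set) \<times> {s :: (real, 'n) vec. \<forall>j. s $ j = 1 \<or> s $ j = -1}"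
  then obtain X s where p: "p = (X, s)" "X \<in> lower_tangent" "\<And>j. s $ j = 1 \<or> s $ j = -1" by auto
  define L where "L = lower_unchart p"
  have d: "re (L $ j $ j) = s $ j * exp (re (X $ j $ j))" for j
    unfolding L_def p(1) by (simp add: lower_unchart_def del: of_real_mult)
  have "L \<in> lower_nz"
    using p(3) by (auto simp: lower_nz_def lower_tangent_def L_def p(1) lower_unchart_def) (metis zero_neq_neg_one zero_neq_one)
  moreover have "ln \<bar>re (L $ j $ j)\<bar> = re (X $ j $ j)" "sgn (re (L $ j $ j)) = s $ j" for j
    using p(3)[of j] by (auto simp: d)
  then have "lower_chart L = p"
    by (auto simp: lower_chart_def p(1) vec_eq_iff not_less_iff_gr_or_eq lower_tangent_upper[OF p(2)]
        lower_tangent_diag[OF p(2), symmetric])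
      (auto simp: L_def p(1) lower_unchart_def)
  ultimately show "p \<in> lower_chart ` lower_nz" by blast
qed

lemma closed_lower_chart_image:
  "closed (lower_chart ` (lower_nz :: ('k::rc_field, 'n::{finite,linorder}) sqmat set))"
  unfolding lower_chart_image
proof (rule closed_Times)
  show "closed (lower_tangent :: ('k, 'n) sqmat set)"
    by (rule closed_subspace[OF subspace_lower_tangent])
  show "closed {s :: (real, 'n) vec. \<forall>j. s $ j = 1 \<or> s $ j = - 1}"
    by (intro closed_Collect_all closed_Collect_disj closed_Collect_eq continuous_intros)
qed

lemma continuous_on_if_const:
  "(c \<Longrightarrow> continuous_on S f) \<Longrightarrow> (\<not> c \<Longrightarrow> continuous_on S g) \<Longrightarrow> continuous_on S (\<lambda>x. if c then f x else g x)"
  by (cases c) auto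

lemma continuous_on_lower_chart:
  "continuous_on (lower_nz :: ('k::rc_field, 'n::{finite,linorder}) sqmat set) lower_chart"
proof -
  have e: "continuous_on lower_nz (\<lambda>L :: ('k, 'n) sqmat. re (L $ i $ j))" for i j
    by (intro bounded_linear.continuous_on[OF bounded_linear_re] continuous_intros)
  show ?thesis
    unfolding lower_chart_def
    by (intro continuous_on_Pair continuous_on_vec_lambda continuous_on_if_const continuous_on_of_real
        continuous_on_ln continuous_on_sgn continuous_on_rabs e continuous_intros ballI)
      (auto simp: lower_nz_re_nz)
qed

lemma continuous_on_lower_unchart: "continuous_on S lower_unchart"
  unfolding lower_unchart_def case_prod_unfold
  by (intro continuous_on_vec_lambda continuous_on_if_const continuous_on_of_real
      continuous_on_mult continuous_on_exp bounded_linear.continuous_on[OF bounded_linear_re] continuous_intros)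

definition lower_nz_dist :: "('k::rc_field, 'n::{finite,linorder}) sqmat \<Rightarrow> ('k, 'n) sqmat \<Rightarrow> real"
  where "lower_nz_dist L K = dist (lower_chart L) (lower_chart K)"

lemma dist_vec_power2: "(dist x y)\<^sup>2 = (\<Sum>i\<in>UNIV. (dist (x $ i) (y $ i))\<^sup>2)"
  unfolding dist_vec_def L2_set_def by (simp add: sum_nonneg)

lemma lower_nz_dist_eq:
  "lower_nz_dist L K =
    sqrt ((\<Sum>i\<in>UNIV. \<Sum>j\<in>UNIV. (if j < i then (norm (L $ i $ j - K $ i $ j))\<^sup>2
        else if i = j then (ln \<bar>re (L $ i $ i)\<bar> - ln \<bar>re (K $ i $ i)\<bar>)\<^sup>2 else 0))
      + (\<Sum>j\<in>UNIV. (sgn (re (L $ j $ j)) - sgn (re (K $ j $ j)))\<^sup>2))"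
  unfolding lower_nz_dist_def lower_chart_def dist_Pair_Pair dist_vec_power2
  by (intro arg_cong[where f = sqrt] arg_cong2[where f = "(+)"] sum.cong refl)
    (auto simp: dist_norm simp flip: of_real_diff)

lemma lower_nz_dist_lower_pos:
  assumes "L \<in> lower_pos" "K \<in> lower_pos"
  shows "lower_nz_dist L K = lower_dist L (K :: ('k::rc_field, 'n::{finite,linorder}) sqmat)"
proof -
  have pos: "0 < re (L $ j $ j)" "0 < re (K $ j $ j)" for j
    using assms by (auto simp: lower_pos_eq)
  let ?a = "\<lambda>i j. (norm (L $ i $ j - K $ i $ j))\<^sup>2"
  let ?b = "\<lambda>j. (ln (re (L $ j $ j)) - ln (re (K $ j $ j)))\<^sup>2"
  have "(\<Sum>i\<in>UNIV. \<Sum>j\<in>UNIV. (if j < i then ?a i j else if i = j then ?b i else 0))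
      = (\<Sum>i\<in>UNIV. \<Sum>j\<in>UNIV. (if j < i then ?a i j else 0) + (if i = j then ?b i else 0))"
    by (intro sum.cong) auto
  also have "\<dots> = (\<Sum>i\<in>UNIV. \<Sum>j\<in>UNIV. if j < i then ?a i j else 0) + (\<Sum>j\<in>UNIV. ?b j)"
    by (simp add: sum.distrib)
  also have "(\<Sum>i\<in>UNIV. \<Sum>j\<in>UNIV. if j < i then ?a i j else 0)
      = (\<Sum>(i, j)\<in>UNIV. if j < i then ?a i j else 0)"
    by (simp add: sum.cartesian_product)
  also have "\<dots> = (\<Sum>(i, j) | j < i. ?a i j)"
    by (intro sum.mono_neutral_cong_right) (auto split: if_splits)
  finally show ?thesis
    by (simp add: lower_nz_dist_eq lower_dist_def abs_of_pos[OF pos(1)] abs_of_pos[OF pos(2)] pos cong: if_cong)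
qed

text \<open>In the chart, multiplication by \<open>H\<close> translates the strictly lower entries
  and the logarithms, and multiplies each sign by a fixed 1 or -1. None of this changes squared
  differences.\<close>

lemma lower_nz_dist_lower_mult:
  fixes H :: "('k::rc_field, 'n::{finite,linorder}) sqmat"
  assumes "H \<in> lower_nz" "L \<in> lower_nz" "K \<in> lower_nz"
  shows "lower_nz_dist (lower_mult H L) (lower_mult H K) = lower_nz_dist L K"
proof -
  have re: "re (H $ j $ j * X $ j $ j) = re (H $ j $ j) * re (X $ j $ j)" for X :: "('k, 'n) sqmat" and j
    using assms(1) by (intro re_mult_Reals) (simp add: lower_nz_def lower_tangent_def)
  have ln: "ln \<bar>re (H $ j $ j) * re (X $ j $ j)\<bar> = ln \<bar>re (H $ j $ j)\<bar> + ln \<bar>re (X $ j $ j)\<bar>"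
    if "X \<in> lower_nz" for X :: "('k, 'n) sqmat" and j
    using lower_nz_re_nz[OF assms(1), of j] lower_nz_re_nz[OF that, of j]
    by (simp add: abs_mult ln_mult)
  have sgn: "(sgn (re (H $ j $ j)) * a - sgn (re (H $ j $ j)) * b)\<^sup>2 = (a - b)\<^sup>2" for a b j
    using lower_nz_re_nz[OF assms(1), of j] by (simp add: sgn_if power2_commute)
  show ?thesis
    unfolding lower_nz_dist_eq lower_mult_nth
    by (intro arg_cong[where f = sqrt] arg_cong2[where f = "(+)"] sum.cong refl)
      (auto simp: re assms(2,3) ln sgn sgn_mult)
qed

lemma separable_space_top_of_set:
  "separable_space (top_of_set (S :: 'a::{metric_space,second_countable_topology} set))"
proof -
  obtain T where T: "countable T" "T \<subseteq> S" "S \<subseteq> closure T" by (rule separable)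
  have "top_of_set S closure_of T = S \<inter> closure (S \<inter> T)"
    by (simp add: closure_of_subtopology)
  also have "S \<inter> T = T" using T(2) by blast
  also have "S \<inter> closure T = S" using T(3) by blast
  finally show ?thesis unfolding separable_space_def using T(1,2) by auto
qed

section \<open>The Riemannian metric on triangular matrices with signed diagonal\<close>

lemma lower_mult_deriv_in_lower_tangent:
  "K \<in> lower_nz \<Longrightarrow> Y \<in> lower_tangent \<Longrightarrow> lower_mult_deriv K Y \<in> lower_tangent"
  by (auto simp: lower_tangent_def lower_mult_deriv_nth lower_nz_def)

lemma lower_metric_eq:
  "lower_metric L X Y = (\<Sum>p | snd p < fst p. re (conjugate (X $ fst p $ snd p) * Y $ fst p $ snd p))
    + (\<Sum>j\<in>UNIV. re (X $ j $ j) * re (Y $ j $ j) / (re (L $ j $ j))\<^sup>2)"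
  by (simp add: lower_metric_def re_sum case_prod_unfold)

text \<open>The diagonal factor of \<open>H\<close> occurs once in each tangent vector and squared
  in the denominator, so it cancels; it may be negative.\<close>

lemma lower_metric_lower_mult:
  assumes "H \<in> lower_nz" "L \<in> lower_nz"
  shows "lower_metric (lower_mult H L) (lower_mult_deriv H X) (lower_mult_deriv H Y)
    = lower_metric L X (Y :: ('k::rc_field, 'n::{finite,linorder}) sqmat)"
proof -
  have re: "re (H $ j $ j * x) = re (H $ j $ j) * re x" for j x
    using assms(1) by (intro re_mult_Reals) (simp add: lower_nz_def lower_tangent_def)
  show ?thesis
    unfolding lower_metric_eq lower_mult_nth lower_mult_deriv_nth
    by (intro arg_cong2[where f = "(+)"] sum.cong refl)
      (auto simp: re lower_nz_re_nz[OF assms(1)] lower_nz_re_nz[OF assms(2)] power2_eq_square)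
qed

lemma inner_product_on_lower_metric:
  assumes "L \<in> lower_nz"
  shows "inner_product_on lower_tangent (lower_metric (L :: ('k::rc_field, 'n::{finite,linorder}) sqmat))"
  unfolding inner_product_on_def
proof (intro conjI ballI allI impI)
  fix X Y Z :: "('k, 'n) sqmat" and c :: real
  show "lower_metric L X Y = lower_metric L Y X"
    unfolding lower_metric_eq using re_conjugate_mult_commute
    by (intro arg_cong2[where f = "(+)"] sum.cong refl) (auto simp: mult.commute)
  show "lower_metric L (X + Y) Z = lower_metric L X Z + lower_metric L Y Z"
    unfolding lower_metric_eq
    by (simp add: conjugate_dist_add re_add sum.distrib distrib_right add_divide_distrib)
  show "lower_metric L (c *\<^sub>R X) Y = c * lower_metric L X Y"
    unfolding lower_metric_eq
    by (simp add: conjugate_scaleR re_scaleR sum_distrib_left distrib_left mult.assoc)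
next
  fix X :: "('k, 'n) sqmat"
  assume X: "X \<in> lower_tangent" "X \<noteq> 0"
  let ?a = "\<lambda>p. re (conjugate (X $ fst p $ snd p) * X $ fst p $ snd p)"
  let ?b = "\<lambda>j. re (X $ j $ j) * re (X $ j $ j) / (re (L $ j $ j))\<^sup>2"
  have a: "0 \<le> ?a p" for p by (simp add: re_conjugate_mult_self)
  have b: "0 \<le> ?b j" for j by simp
  obtain i j where ij: "X $ i $ j \<noteq> 0" using X(2) by (auto simp: vec_eq_iff)
  then have "\<not> i < j" using X(1) by (auto simp: lower_tangent_def)
  then consider "j < i" | "i = j" by fastforce
  then show "0 < lower_metric L X X"
  proof cases
    case 1
    have "0 < ?a (i, j)" using ij by (simp add: re_conjugate_mult_self)
    then have "0 < (\<Sum>p | snd p < fst p. ?a p)"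
      using 1 a by (intro sum_pos2[of _ "(i, j)"]) auto
    moreover have "0 \<le> (\<Sum>j\<in>UNIV. ?b j)" using b by (rule sum_nonneg)
    ultimately show ?thesis unfolding lower_metric_eq by linarith
  next
    case 2
    \<comment> \<open>The metric only sees real parts on the diagonal; definiteness holds because
      the diagonal of a tangent vector is real.\<close>
    have "re (X $ j $ j) \<noteq> 0"
    proof
      assume "re (X $ j $ j) = 0"
      then show False using lower_tangent_diag[OF X(1), of j] ij 2 by simp
    qed
    then have "0 < ?b j" using lower_nz_re_nz[OF assms, of j]
      by (simp add: divide_pos_pos flip: power2_eq_square)
    then have "0 < (\<Sum>j\<in>UNIV. ?b j)"
      using b by (intro sum_pos2[of _ j]) auto
    moreover have "0 \<le> (\<Sum>p | snd p < fst p. ?a p)" using a by (rule sum_nonneg)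
    ultimately show ?thesis unfolding lower_metric_eq by linarith
  qed
qed

text \<open>The two vectors may vary with the base point: a fixed tangent vector of the cone becomes
  a varying one after applying the derivative of the chart.\<close>

lemma smooth_on_lower_metric:
  assumes "smooth_on V U L" "smooth_on V U X" "smooth_on V U Y"
    and "\<And>x. x \<in> U \<Longrightarrow> L x \<in> (lower_nz :: ('k::rc_field, 'n::{finite,linorder}) sqmat set)"
  shows "smooth_on V U (\<lambda>x. lower_metric (L x) (X x) (Y x))"
  unfolding lower_metric_eq divide_inverse power2_eq_square
  by (intro smooth_on_add smooth_on_sum smooth_on_mult smooth_on_inverse
      smooth_on_linear_compose[OF bounded_linear_re] smooth_on_linear_compose[OF bounded_linear_conjugate]
      smooth_on_vec_nth assms) (use lower_nz_re_nz[OF assms(4)] in auto)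

section \<open>Transport to a cone\<close>

text \<open>\<open>\<Psi>\<close> extends the Cholesky map \<open>\<Phi>\<close> from
  \<open>lower_pos\<close> to all sign patterns, and \<open>C\<close> is its inverse.
  \<open>\<Phi>\<close> is kept apart because \<open>log_cholesky_metric\<close> differentiates it
  on the full matrix space, while \<open>\<Psi>\<close> is only smooth within
  \<open>lower_nz\<close>.\<close>

locale cholesky_chart =
  fixes M :: "('k::rc_field, 'n::{finite,linorder}) sqmat set"
    and \<Phi> \<Psi> C :: "('k, 'n) sqmat \<Rightarrow> ('k, 'n) sqmat"
  assumes openin_M: "openin (top_of_set hermitian) M"
    and C_in: "A \<in> M \<Longrightarrow> C A \<in> lower_nz" and \<Psi>_C: "A \<in> M \<Longrightarrow> \<Psi> (C A) = A"
    and \<Psi>_in: "L \<in> lower_nz \<Longrightarrow> \<Psi> L \<in> M" and C_\<Psi>: "L \<in> lower_nz \<Longrightarrow> C (\<Psi> L) = L"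
    and smooth_\<Psi>: "smooth_on lower_tangent lower_nz \<Psi>"
    and smooth_C: "smooth_on hermitian M C"
    and \<Psi>_eq_\<Phi>: "L \<in> lower_pos \<Longrightarrow> \<Psi> L = \<Phi> L"
    and PD_eq: "PD = \<Psi> ` lower_pos"
    and \<Phi>_differentiable: "\<Phi> differentiable (at L)"
begin

definition G :: "('k, 'n) sqmat monoid"
  where "G = \<lparr>carrier = M, monoid.mult = (\<lambda>A B. \<Psi> (lower_mult (C A) (C B))), one = \<Psi> (mat 1)\<rparr>"

definition d :: "('k, 'n) sqmat \<Rightarrow> ('k, 'n) sqmat \<Rightarrow> real"
  where "d A B = lower_nz_dist (C A) (C B)"

text \<open>A derivative within \<open>M\<close> picked by choice; exactly its values on
  \<open>hermitian\<close> are determined.\<close>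

definition dC :: "('k, 'n) sqmat \<Rightarrow> ('k, 'n) sqmat \<Rightarrow> ('k, 'n) sqmat"
  where "dC A = frechet_derivative C (at A within M)"

definition d\<Psi> :: "('k, 'n) sqmat \<Rightarrow> ('k, 'n) sqmat \<Rightarrow> ('k, 'n) sqmat"
  where "d\<Psi> L = frechet_derivative \<Psi> (at L within lower_nz)"

definition g :: "('k, 'n) sqmat \<Rightarrow> ('k, 'n) sqmat \<Rightarrow> ('k, 'n) sqmat \<Rightarrow> real"
  where "g A X Y = lower_metric (C A) (dC A X) (dC A Y)"

lemmas lower_pos_nz = subsetD[OF lower_pos_subset_lower_nz]

lemma G_simps [simp]: "carrier G = M" "A \<otimes>\<^bsub>G\<^esub> B = \<Psi> (lower_mult (C A) (C B))" "\<one>\<^bsub>G\<^esub> = \<Psi> (mat 1)"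
  by (simp_all add: G_def)

lemma M_subset: "M \<subseteq> hermitian"
  using openin_M openin_imp_subset by blast

lemma PD_iff: "A \<in> PD \<longleftrightarrow> A \<in> M \<and> C A \<in> lower_pos"
proof
  assume "A \<in> PD"
  then obtain L where "L \<in> lower_pos" "A = \<Psi> L" unfolding PD_eq by blast
  then show "A \<in> M \<and> C A \<in> lower_pos"
    using \<Psi>_in[OF lower_pos_nz] C_\<Psi>[OF lower_pos_nz] by simp
next
  assume "A \<in> M \<and> C A \<in> lower_pos"
  then show "A \<in> PD" unfolding PD_eq using \<Psi>_C[of A] by (metis imageI)
qed

section \<open>The transported Lie group\<close>

lemma mult_in: "A \<in> M \<Longrightarrow> B \<in> M \<Longrightarrow> \<Psi> (lower_mult (C A) (C B)) \<in> M"
  by (intro \<Psi>_in lower_mult_in_lower_nz C_in)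

lemma C_mult: "A \<in> M \<Longrightarrow> B \<in> M \<Longrightarrow> C (\<Psi> (lower_mult (C A) (C B))) = lower_mult (C A) (C B)"
  by (intro C_\<Psi> lower_mult_in_lower_nz C_in)

lemma C_one: "C (\<Psi> (mat 1)) = mat 1" and one_in: "\<Psi> (mat 1) \<in> M"
  by (simp_all add: C_\<Psi> \<Psi>_in lower_pos_nz mat_1_in_lower_pos)

lemma inv_law: "A \<in> M \<Longrightarrow> \<Psi> (lower_mult (C (\<Psi> (lower_inv (C A)))) (C A)) = \<Psi> (mat 1)"
  by (simp add: C_\<Psi> lower_inv_in_lower_nz C_in lower_inv_mult)

lemma comm_group_G: "comm_group G"
proof (rule comm_groupI)
  fix x assume "x \<in> carrier G"
  then show "\<exists>y\<in>carrier G. y \<otimes>\<^bsub>G\<^esub> x = \<one>\<^bsub>G\<^esub>"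
    using inv_law by (auto intro!: bexI[of _ "\<Psi> (lower_inv (C x))"] \<Psi>_in lower_inv_in_lower_nz C_in)
qed (auto simp: mult_in one_in C_mult lower_mult_assoc C_one lower_mult_1 C_in \<Psi>_C
    intro: arg_cong[OF lower_mult_commute])

lemma group_G: "group G"
  using comm_group_G by (simp add: comm_group_def)

lemma inv_G: "A \<in> M \<Longrightarrow> inv\<^bsub>G\<^esub> A = \<Psi> (lower_inv (C A))"
  by (rule group.inv_equality[OF group_G]) (simp_all add: inv_law \<Psi>_in lower_inv_in_lower_nz C_in)

lemma smooth_inv: "smooth_on hermitian M (\<lambda>A. inv\<^bsub>G\<^esub> A)"
proof (rule smooth_on_cong)
  have "smooth_on hermitian M (\<lambda>A. lower_inv (C A))"
    by (rule smooth_on_compose[OF smooth_C smooth_on_lower_inv[of lower_tangent] _ subspace_hermitian openin_M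
          subspace_lower_tangent lower_nz_subset_lower_tangent]) (use C_in in auto)
  then show "smooth_on hermitian M (\<lambda>A. \<Psi> (lower_inv (C A)))"
    by (rule smooth_on_compose[OF _ smooth_\<Psi> _ subspace_hermitian openin_M
          subspace_lower_tangent lower_nz_subset_lower_tangent])
      (use C_in lower_inv_in_lower_nz in auto)
qed (simp add: inv_G)

lemma smooth_mult: "smooth_on (hermitian \<times> hermitian) (M \<times> M) (\<lambda>(A, B). A \<otimes>\<^bsub>G\<^esub> B)"
proof -
  let ?V = "hermitian \<times> hermitian :: (('k, 'n) sqmat \<times> ('k, 'n) sqmat) set"
  have V: "subspace ?V" by (intro subspace_Times subspace_hermitian)
  have U: "openin (top_of_set ?V) (M \<times> M)" using openin_M by (simp add: openin_Times)
  have "smooth_on ?V (M \<times> M) (\<lambda>p. C (fst p))"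
    by (rule smooth_on_compose[OF smooth_on_linear[OF bounded_linear_fst] smooth_C _ V U
          subspace_hermitian M_subset]) auto
  moreover have "smooth_on ?V (M \<times> M) (\<lambda>p. C (snd p))"
    by (rule smooth_on_compose[OF smooth_on_linear[OF bounded_linear_snd] smooth_C _ V U
          subspace_hermitian M_subset]) auto
  ultimately have "smooth_on ?V (M \<times> M) (\<lambda>p. (C (fst p), C (snd p)))"
    by (rule smooth_on_Pair)
  from smooth_on_compose[OF this smooth_on_lower_mult[of "lower_tangent \<times> lower_tangent" "lower_nz \<times> lower_nz"]
      _ V U subspace_Times[OF subspace_lower_tangent subspace_lower_tangent]]
  have "smooth_on ?V (M \<times> M) (\<lambda>p. lower_mult (C (fst p)) (C (snd p)))"
    using C_in lower_nz_subset_lower_tangent by fastforce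
  from smooth_on_compose[OF this smooth_\<Psi> _ V U subspace_lower_tangent lower_nz_subset_lower_tangent]
  show ?thesis
    using C_in lower_mult_in_lower_nz by (fastforce simp: case_prod_unfold)
qed

lemma lie_group_on_G: "lie_group_on hermitian G"
  unfolding lie_group_on_def G_simps(1)
  using group_G subspace_hermitian openin_M smooth_mult smooth_inv by blast

section \<open>The transported distance and Riemannian metric\<close>

lemma d_eq: "d = (\<lambda>A B. dist (lower_chart (C A)) (lower_chart (C B)))"
  by (simp add: fun_eq_iff d_def lower_nz_dist_def)

lemma C_image: "C ` M = lower_nz"
  using C_in \<Psi>_in C_\<Psi> by (force simp: image_iff)

lemma metric:
  shows Metric_space_d: "Metric_space M d"
    and mtopology_d: "Metric_space.mtopology M d = top_of_set M"
    and mcomplete_d: "Metric_space.mcomplete M d"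
proof -
  let ?F = "\<lambda>A. lower_chart (C A)"
  let ?H = "\<lambda>p. \<Psi> (lower_unchart p)"
  have im: "?F ` M = lower_chart ` lower_nz" using C_image by (simp flip: image_image)
  have F: "continuous_on M ?F"
    by (rule continuous_on_compose2[OF continuous_on_lower_chart smooth_on_imp_continuous_on[OF smooth_C]])
      (simp add: C_image)
  have H: "continuous_on (?F ` M) ?H"
    unfolding im
    by (rule continuous_on_compose2[OF smooth_on_imp_continuous_on[OF smooth_\<Psi>] continuous_on_lower_unchart])
      (auto simp: lower_unchart_chart)
  have HF: "?H (?F A) = A" if "A \<in> M" for A
    using that by (simp add: lower_unchart_chart C_in \<Psi>_C)
  have cl: "closed (?F ` M)" unfolding im by (rule closed_lower_chart_image)
  show "Metric_space M d" "Metric_space.mtopology M d = top_of_set M" "Metric_space.mcomplete M d"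
    unfolding d_eq by (rule pullback_metric[OF F H HF cl], assumption)+
qed

lemma bi_invariant_d: "bi_invariant_dist G d"
  unfolding bi_invariant_dist_def G_simps
proof (intro ballI conjI)
  fix a x y assume "a \<in> M" "x \<in> M" "y \<in> M"
  then show "d (\<Psi> (lower_mult (C a) (C x))) (\<Psi> (lower_mult (C a) (C y))) = d x y"
    by (simp add: d_def C_mult lower_nz_dist_lower_mult C_in)
  then show "d (\<Psi> (lower_mult (C x) (C a))) (\<Psi> (lower_mult (C y) (C a))) = d x y"
    by (simp only: lower_mult_commute[of _ "C a"])
qed

lemma has_derivative_C: "A \<in> M \<Longrightarrow> (C has_derivative dC A) (at A within M)"
  unfolding dC_def using smooth_on_imp_has_derivative[OF smooth_C]
  by (metis differentiableI frechet_derivative_works)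

lemma has_derivative_\<Psi>: "L \<in> lower_nz \<Longrightarrow> (\<Psi> has_derivative d\<Psi> L) (at L within lower_nz)"
  unfolding d\<Psi>_def using smooth_on_imp_has_derivative[OF smooth_\<Psi>]
  by (metis differentiableI frechet_derivative_works)

lemma dC_in: "A \<in> M \<Longrightarrow> X \<in> hermitian \<Longrightarrow> dC A X \<in> lower_tangent"
  by (rule has_derivative_in_subspace[OF has_derivative_C _ _ openin_M subspace_hermitian _
        subspace_lower_tangent closed_subspace[OF subspace_lower_tangent]])
    (use C_in lower_nz_subset_lower_tangent in auto)

text \<open>Differentiate \<open>\<Psi> (C B) = B\<close> along \<open>M\<close>; uniqueness on
  \<open>hermitian\<close> identifies the composed derivative with the identity there. The next
  lemma does the same for the other composition.\<close>

lemma d\<Psi>_dC: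
  assumes "A \<in> M" "X \<in> hermitian"
  shows "d\<Psi> (C A) (dC A X) = X"
proof -
  have "(\<Psi> has_derivative d\<Psi> (C A)) (at (C A) within C ` M)"
    unfolding C_image by (rule has_derivative_\<Psi>[OF C_in[OF assms(1)]])
  then have "((\<lambda>B. \<Psi> (C B)) has_derivative (\<lambda>X. d\<Psi> (C A) (dC A X))) (at A within M)"
    by (rule has_derivative_in_compose[of C "dC A" A M \<Psi> "d\<Psi> (C A)", OF has_derivative_C[OF assms(1)]])
  then have "((\<lambda>B. B) has_derivative (\<lambda>X. d\<Psi> (C A) (dC A X))) (at A within M)"
    by (rule has_derivative_transform[OF assms(1), rotated]) (simp add: \<Psi>_C)
  from has_derivative_unique_on_subspace[OF this has_derivative_ident assms openin_M subspace_hermitian]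
  show ?thesis .
qed

lemma dC_d\<Psi>:
  assumes "L \<in> lower_nz" "Y \<in> lower_tangent"
  shows "dC (\<Psi> L) (d\<Psi> L Y) = Y"
proof -
  have "(C has_derivative dC (\<Psi> L)) (at (\<Psi> L) within \<Psi> ` lower_nz)"
    by (rule has_derivative_subset[OF has_derivative_C[OF \<Psi>_in[OF assms(1)]]]) (use \<Psi>_in in auto)
  then have "((\<lambda>K. C (\<Psi> K)) has_derivative (\<lambda>Y. dC (\<Psi> L) (d\<Psi> L Y))) (at L within lower_nz)"
    by (rule has_derivative_in_compose[of \<Psi> "d\<Psi> L" L lower_nz C "dC (\<Psi> L)",
          OF has_derivative_\<Psi>[OF assms(1)]])
  then have "((\<lambda>K. K) has_derivative (\<lambda>Y. dC (\<Psi> L) (d\<Psi> L Y))) (at L within lower_nz)"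
    by (rule has_derivative_transform[OF assms(1), rotated]) (simp add: C_\<Psi>)
  from has_derivative_unique_on_subspace[OF this has_derivative_ident assms openin_lower_nz
      subspace_lower_tangent]
  show ?thesis .
qed

lemma linear_dC: "A \<in> M \<Longrightarrow> linear (dC A)"
  using has_derivative_C has_derivative_linear by blast

lemma riemannian_metric_on_g: "riemannian_metric_on hermitian M g"
  unfolding riemannian_metric_on_def
proof (intro conjI ballI subspace_hermitian openin_M)
  fix A assume A: "A \<in> M"
  have ip: "inner_product_on lower_tangent (lower_metric (C A))"
    by (rule inner_product_on_lower_metric[OF C_in[OF A]])
  \<comment> \<open>Injectivity of the derivative on tangent vectors is what lets definiteness
    survive the pullback.\<close>
  have nz: "dC A X \<noteq> 0" if "X \<in> hermitian" "X \<noteq> 0" for X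
  proof
    assume "dC A X = 0"
    moreover have "linear (d\<Psi> (C A))" using has_derivative_\<Psi>[OF C_in[OF A]] has_derivative_linear by blast
    ultimately have "d\<Psi> (C A) (dC A X) = 0" by (simp add: linear_0)
    then show False using d\<Psi>_dC[OF A that(1)] that(2) by simp
  qed
  show "inner_product_on hermitian (g A)"
    using ip dC_in[OF A] nz unfolding inner_product_on_def g_def
    by (simp add: linear_add[OF linear_dC[OF A]] linear_cmul[OF linear_dC[OF A]])
next
  fix v w :: "('k, 'n) sqmat" assume "v \<in> hermitian" "w \<in> hermitian"
  then show "smooth_on hermitian M (\<lambda>A. g A v w)"
    unfolding g_def
    by (intro smooth_on_lower_metric smooth_C C_in
        smooth_on_derivative[OF smooth_C has_derivative_C _ openin_M subspace_hermitian])
qed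

text \<open>The translation is \<open>\<Psi>\<close> after \<open>lower_mult (C a)\<close> after
  \<open>C\<close>. Measuring its derivative with \<open>g\<close> applies \<open>dC\<close> at the
  image point, which cancels \<open>d\<Psi>\<close>, and what remains is the invariance of
  \<open>lower_metric\<close>.\<close>

lemma isometric_mult:
  assumes a: "a \<in> M"
  shows "isometric_on hermitian M g (\<lambda>x. a \<otimes>\<^bsub>G\<^esub> x)"
  unfolding isometric_on_def
proof
  fix x assume x: "x \<in> M"
  let ?m = "lower_mult (C a)" and ?m' = "lower_mult_deriv (C a)"
  let ?K = "?m (C x)"
  have K: "?K \<in> lower_nz" using a x by (intro lower_mult_in_lower_nz C_in)
  have "((\<lambda>y. ?m (C y)) has_derivative (\<lambda>v. ?m' (dC x v))) (at x within M)"
  proof (rule has_derivative_in_compose[OF has_derivative_C[OF x]])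
    show "(?m has_derivative ?m') (at (C x) within C ` M)"
      by (rule has_derivative_lower_mult)
  qed
  moreover have "(\<Psi> has_derivative d\<Psi> ?K) (at ?K within (\<lambda>y. ?m (C y)) ` M)"
    by (rule has_derivative_subset[OF has_derivative_\<Psi>[OF K]])
      (use a in \<open>auto intro!: lower_mult_in_lower_nz C_in\<close>)
  ultimately have D: "((\<lambda>y. \<Psi> (?m (C y))) has_derivative (\<lambda>v. d\<Psi> ?K (?m' (dC x v)))) (at x within M)"
    by (rule has_derivative_in_compose[of "\<lambda>y. ?m (C y)" "\<lambda>v. ?m' (dC x v)" x M \<Psi> "d\<Psi> ?K"])
  have "g (\<Psi> ?K) (d\<Psi> ?K (?m' (dC x v))) (d\<Psi> ?K (?m' (dC x w))) = g x v w"
    if "v \<in> hermitian" "w \<in> hermitian" for v w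
    unfolding g_def
    by (simp add: dC_d\<Psi>[OF K] C_\<Psi>[OF K] lower_mult_deriv_in_lower_tangent dC_in that a x C_in
        lower_metric_lower_mult)
  with D show "\<exists>f'. ((\<lambda>y. a \<otimes>\<^bsub>G\<^esub> y) has_derivative f') (at x within M)
      \<and> (\<forall>v\<in>hermitian. \<forall>w\<in>hermitian. g (a \<otimes>\<^bsub>G\<^esub> x) (f' v) (f' w) = g x v w)"
    unfolding G_simps by blast
qed

lemma bi_invariant_g: "bi_invariant_riemannian hermitian G g"
  unfolding bi_invariant_riemannian_def
proof (intro ballI conjI)
  fix a assume "a \<in> carrier G"
  then show l: "isometric_on hermitian (carrier G) g (\<lambda>x. a \<otimes>\<^bsub>G\<^esub> x)"
    using isometric_mult by (simp only: G_simps(1))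
  have "(\<lambda>x. x \<otimes>\<^bsub>G\<^esub> a) = (\<lambda>x. a \<otimes>\<^bsub>G\<^esub> x)"
    unfolding G_simps by (simp only: lower_mult_commute[of _ "C a"])
  then show "isometric_on hermitian (carrier G) g (\<lambda>x. x \<otimes>\<^bsub>G\<^esub> a)"
    using l by (simp only:)
qed

section \<open>The positive definite cone as identity component, and its cosets\<close>

lemma subgroup_PD: "subgroup PD G"
proof (rule group.subgroupI[OF group_G])
  show "PD \<subseteq> carrier G" using PD_iff by auto
  have "\<Psi> (mat 1) \<in> PD" unfolding PD_eq by (intro imageI mat_1_in_lower_pos)
  then show "(PD :: ('k, 'n) sqmat set) \<noteq> {}" by blast
  show "inv\<^bsub>G\<^esub> A \<in> PD" if "A \<in> PD" for A
    using that unfolding PD_iff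
    by (simp add: inv_G \<Psi>_in C_\<Psi> lower_inv_in_lower_nz lower_inv_in_lower_pos C_in)
  show "A \<otimes>\<^bsub>G\<^esub> B \<in> PD" if "A \<in> PD" "B \<in> PD" for A B
    using that unfolding PD_iff by (simp add: mult_in C_mult lower_mult_in_lower_pos)
qed

text \<open>The diagonal entries of \<open>C\<close> are continuous and never zero on
  \<open>M\<close>, and they are 1 at the unit, so they stay positive on any connected set through
  it. Conversely, \<open>PD\<close> is the continuous image of the convex set
  \<open>lower_pos\<close>.\<close>

lemma connected_component_one: "connected_component_set M \<one>\<^bsub>G\<^esub> = PD"
proof (intro equalityI subsetI)
  fix A assume "A \<in> connected_component_set M \<one>\<^bsub>G\<^esub>"
  then obtain S where S: "connected S" "S \<subseteq> M" "\<Psi> (mat 1) \<in> S" "A \<in> S"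
    by (auto simp: connected_component_def)
  have "0 < re (C A $ j $ j)" for j
  proof (rule ccontr)
    assume neg: "\<not> 0 < re (C A $ j $ j)"
    let ?r = "\<lambda>B. re (C B $ j $ j)"
    have "continuous_on S ?r"
      using continuous_on_subset[OF smooth_on_imp_continuous_on[OF smooth_C] S(2)]
      by (intro bounded_linear.continuous_on[OF bounded_linear_re] continuous_intros)
    then have "connected (?r ` S)" using S(1) by (rule connected_continuous_image)
    moreover have "?r A \<in> ?r ` S" "?r (\<Psi> (mat 1)) \<in> ?r ` S" using S by blast+
    ultimately have "0 \<in> ?r ` S"
      by (rule connectedD_interval) (use neg in \<open>simp_all add: C_one, simp_all add: mat_def\<close>)
    then show False using S(2) lower_nz_re_nz[OF C_in] by force
  qed
  then show "A \<in> PD"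
    using S(2,4) C_in lower_nz_subset_lower_tangent by (auto simp: PD_iff lower_pos_eq)
next
  have "convex (lower_pos :: ('k, 'n) sqmat set)"
  proof (rule convexI)
    fix x y :: "('k, 'n) sqmat" and u v :: real
    assume "x \<in> lower_pos" "y \<in> lower_pos" and uv: "0 \<le> u" "0 \<le> v" "u + v = 1"
    then have t: "x \<in> lower_tangent" "y \<in> lower_tangent"
      and p: "0 < re (x $ j $ j)" "0 < re (y $ j $ j)" for j
      by (auto simp: lower_pos_eq)
    have "u *\<^sub>R x + v *\<^sub>R y \<in> lower_tangent"
      using t by (intro subspace_add subspace_scale subspace_lower_tangent)
    moreover have "0 < u * re (x $ j $ j) + v * re (y $ j $ j)" for j
    proof (cases "u = 0")
      case True
      then show ?thesis using uv p by simp
    next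
      case False
      then show ?thesis using uv p by (simp add: add_pos_nonneg less_imp_le)
    qed
    ultimately show "u *\<^sub>R x + v *\<^sub>R y \<in> lower_pos"
      by (simp add: lower_pos_eq re_add re_scaleR)
  qed
  then have "connected (PD :: ('k, 'n) sqmat set)"
    unfolding PD_eq
    by (intro connected_continuous_image convex_connected
        continuous_on_subset[OF smooth_on_imp_continuous_on[OF smooth_\<Psi>] lower_pos_subset_lower_nz])
  then have "PD \<subseteq> connected_component_set M \<one>\<^bsub>G\<^esub>"
    by (intro connected_component_maximal) (use PD_iff PD_eq mat_1_in_lower_pos in auto)
  then show "A \<in> PD \<Longrightarrow> A \<in> connected_component_set M \<one>\<^bsub>G\<^esub>" for A by blast
qed

definition neg_set :: "('k, 'n) sqmat \<Rightarrow> 'n set"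
  where "neg_set A = {j. re (C A $ j $ j) < 0}"

text \<open>Multiplication by an element of \<open>PD\<close> scales the diagonal by positive
  numbers and so preserves signs. If two sign patterns agree, the quotient has positive
  diagonal.\<close>

lemma r_coset_PD:
  assumes a: "a \<in> M"
  shows "PD #>\<^bsub>G\<^esub> a = {x \<in> M. neg_set x = neg_set a}"
proof (intro equalityI subsetI)
  have re: "re (x $ j $ j * y) = re (x $ j $ j) * re y" if "x \<in> lower_nz" for x :: "('k, 'n) sqmat" and j y
    using that by (intro re_mult_Reals) (simp add: lower_nz_def lower_tangent_def)
  {
    fix x assume "x \<in> PD #>\<^bsub>G\<^esub> a"
    then obtain p where p: "p \<in> PD" "x = \<Psi> (lower_mult (C p) (C a))"
      unfolding r_coset_def by auto
    then have pM: "p \<in> M" "C p \<in> lower_pos" by (auto simp: PD_iff)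
    have pos: "0 < re (C p $ j $ j)" for j using pM(2) by (simp add: lower_pos_eq)
    have "re (C x $ j $ j) = re (C p $ j $ j) * re (C a $ j $ j)" for j
      using pM(1) a by (simp add: p(2) C_mult lower_mult_nth re C_in)
    then have "re (C x $ j $ j) < 0 \<longleftrightarrow> re (C a $ j $ j) < 0" for j
      by (simp add: mult_less_0_iff pos less_not_sym[OF pos])
    then show "x \<in> {x \<in> M. neg_set x = neg_set a}"
      using pM(1) a by (simp add: neg_set_def p(2) mult_in)
  next
    fix x assume "x \<in> {x \<in> M. neg_set x = neg_set a}"
    then have x: "x \<in> M" and ns: "re (C x $ j $ j) < 0 \<longleftrightarrow> re (C a $ j $ j) < 0" for j
      by (auto simp: neg_set_def)
    \<comment> \<open>The factor of the quotient of \<open>x\<close> by \<open>a\<close> in the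
      group.\<close>
    define P where "P = lower_mult (C x) (lower_inv (C a))"
    have P: "P \<in> lower_nz" unfolding P_def using x a by (intro lower_mult_in_lower_nz lower_inv_in_lower_nz C_in)
    have "0 < re (P $ j $ j)" for j
    proof -
      have "re (C a $ j $ j * inverse (C a $ j $ j)) = re (C a $ j $ j) * re (inverse (C a $ j $ j))"
        using re[OF C_in[OF a]] .
      moreover have "C a $ j $ j \<noteq> 0" using C_in[OF a] by (simp add: lower_nz_def)
      ultimately have 1: "re (C a $ j $ j) * re (inverse (C a $ j $ j)) = 1" by simp
      have "0 < re (C x $ j $ j) * re (inverse (C a $ j $ j))"
      proof (cases "re (C a $ j $ j) < 0")
        case True
        moreover have "re (inverse (C a $ j $ j)) < 0"
          using 1 True by (metis mult_nonpos_nonneg not_less less_imp_le not_one_le_zero)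
        ultimately show ?thesis using ns[of j] by (simp add: mult_neg_neg)
      next
        case False
        then have "0 < re (C a $ j $ j)" "0 < re (C x $ j $ j)"
          using ns[of j] lower_nz_re_nz[OF C_in[OF x], of j] lower_nz_re_nz[OF C_in[OF a], of j] by linarith+
        moreover from this(1) have "0 < re (inverse (C a $ j $ j))"
          using 1 by (metis mult_nonneg_nonpos not_less less_imp_le not_one_le_zero)
        ultimately show ?thesis by simp
      qed
      then show ?thesis
        by (simp add: P_def lower_mult_nth lower_inv_def re[OF C_in[OF x]])
    qed
    then have Ppos: "P \<in> lower_pos" using P lower_nz_subset_lower_tangent by (auto simp: lower_pos_eq)
    have "lower_mult P (C a) = C x"
      unfolding P_def lower_mult_assoc lower_inv_mult[OF C_in[OF a]]
      by (simp add: lower_mult_commute[of _ "mat 1"] lower_mult_1 C_in x)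
    then have "x = \<Psi> P \<otimes>\<^bsub>G\<^esub> a" using x by (simp add: C_\<Psi>[OF P] \<Psi>_C)
    then show "x \<in> PD #>\<^bsub>G\<^esub> a" unfolding r_coset_def PD_eq using Ppos by blast
  }
qed

text \<open>Cosets correspond to the sets of indices with negative diagonal entry, and diagonal sign
  matrices realize every such set.\<close>

lemma card_rcosets_PD: "card (rcosets\<^bsub>G\<^esub> PD) = 2 ^ CARD('n)"
proof -
  have ex: "\<exists>a\<in>M. neg_set a = S" for S
  proof
    define L :: "('k, 'n) sqmat" where "L = (\<chi> i j. if i = j then (if i \<in> S then -1 else 1) else 0)"
    have "L \<in> lower_nz" by (auto simp: L_def lower_nz_def lower_tangent_def)
    moreover have "re (-1 :: 'k) = - 1" using re_of_real[of "-1", where 'k = 'k] by simp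
    ultimately show "neg_set (\<Psi> L) = S" "\<Psi> L \<in> M"
      by (auto simp: neg_set_def C_\<Psi> \<Psi>_in L_def)
  qed
  let ?F = "\<lambda>S. {x \<in> M. neg_set x = S}"
  have "rcosets\<^bsub>G\<^esub> PD = (\<Union>a\<in>M. {?F (neg_set a)})"
    unfolding RCOSETS_def G_simps(1) by (intro SUP_cong refl) (simp only: r_coset_PD)
  also have "\<dots> = ?F ` neg_set ` M" by auto
  also have "neg_set ` M = UNIV" using ex by (metis UNIV_eq_I imageI)
  finally have "rcosets\<^bsub>G\<^esub> PD = range ?F" .
  moreover have "inj ?F"
  proof (rule injI)
    fix S T assume eq: "?F S = ?F T"
    obtain a where "a \<in> M" "neg_set a = S" using ex by blast
    then have "a \<in> ?F T" unfolding eq[symmetric] by simp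
    then show "S = T" using \<open>neg_set a = S\<close> by simp
  qed
  ultimately have "card (rcosets\<^bsub>G\<^esub> PD) = card (UNIV :: 'n set set)"
    by (simp only: card_image)
  also have "\<dots> = 2 ^ CARD('n)"
    using card_Pow[of "UNIV :: 'n set"] by simp
  finally show ?thesis .
qed

section \<open>Agreement with the log-Cholesky structure on \<open>PD\<close>\<close>

lemma cholesky_factor_eq:
  assumes "A \<in> PD"
  shows "cholesky_factor \<Phi> A = C A"
proof -
  have "inj_on \<Phi> lower_pos"
    by (metis C_\<Psi> \<Psi>_eq_\<Phi> inj_onI lower_pos_nz)
  moreover have "A = \<Phi> (C A)" "C A \<in> lower_pos"
    using assms \<Psi>_eq_\<Phi>[of "C A"] \<Psi>_C[of A] by (auto simp: PD_iff)
  ultimately show ?thesis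
    unfolding cholesky_factor_def by (metis the_inv_into_f_f)
qed

text \<open>The full derivative of \<open>\<Phi>\<close> and the derivative \<open>d\<Psi>\<close>
  within \<open>lower_nz\<close> are both derivatives of \<open>\<Phi>\<close> within the relatively
  open \<open>lower_pos\<close>, so they agree on \<open>lower_tangent\<close>. There
  \<open>dC A\<close> inverts them, hence it equals the \<open>the_inv_into\<close> of the
  definition on Hermitian matrices.\<close>

lemma g_eq_log_cholesky_metric:
  assumes A: "A \<in> PD" and XY: "X \<in> hermitian" "Y \<in> hermitian"
  shows "g A X Y = log_cholesky_metric \<Phi> A X Y"
proof -
  define P where "P = frechet_derivative \<Phi> (at (C A))"
  have AM: "A \<in> M" and L: "C A \<in> lower_pos" using A by (auto simp: PD_iff)
  have "(\<Phi> has_derivative P) (at (C A) within lower_pos)"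
    unfolding P_def using \<Phi>_differentiable frechet_derivative_works has_derivative_at_withinI by blast
  moreover have "(\<Phi> has_derivative d\<Psi> (C A)) (at (C A) within lower_pos)"
    by (rule has_derivative_transform[OF L, rotated],
        rule has_derivative_subset[OF has_derivative_\<Psi>[OF C_in[OF AM]] lower_pos_subset_lower_nz])
      (simp add: \<Psi>_eq_\<Phi>)
  ultimately have P: "P Z = d\<Psi> (C A) Z" if "Z \<in> lower_tangent" for Z
    using has_derivative_unique_on_subspace[OF _ _ L that openin_lower_pos subspace_lower_tangent] by blast
  have inj: "inj_on P lower_tangent"
    by (rule inj_on_inverseI[of _ "dC A"]) (use P dC_d\<Psi>[OF C_in[OF AM]] \<Psi>_C[OF AM] in auto)
  have "the_inv_into lower_tangent P Z = dC A Z" if "Z \<in> hermitian" for Z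
    using the_inv_into_f_f[OF inj dC_in[OF AM that]] P[OF dC_in[OF AM that]] d\<Psi>_dC[OF AM that] by simp
  then show ?thesis
    by (simp add: g_def log_cholesky_metric_def Let_def cholesky_factor_eq[OF A] XY flip: P_def)
qed

lemma log_cholesky_extension: "log_cholesky_extension \<Phi> M G d g"
  unfolding log_cholesky_extension_def
proof (intro conjI ballI)
  show "separable_space (Metric_space.mtopology M d)"
    unfolding mtopology_d by (rule separable_space_top_of_set)
  fix A B :: "('k, 'n) sqmat" assume AB: "A \<in> PD" "B \<in> PD"
  then show "d A B = log_cholesky_dist \<Phi> A B"
    unfolding d_def log_cholesky_dist_def
    by (simp add: cholesky_factor_eq lower_nz_dist_lower_pos PD_iff)
  show "A \<otimes>\<^bsub>G\<^esub> B = log_cholesky_mult \<Phi> A B"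
    using AB by (simp add: log_cholesky_mult_def cholesky_factor_eq PD_iff \<Psi>_eq_\<Phi> lower_mult_in_lower_pos)
qed (simp_all only: G_simps(1) comm_group_G lie_group_on_G metric bi_invariant_d riemannian_metric_on_g
    bi_invariant_g subgroup_PD connected_component_one card_rcosets_PD g_eq_log_cholesky_metric)

end

section \<open>Signed Cholesky factorization\<close>

text \<open>Padding the block by the identity keeps the matrix type, so determinants of blocks obey
  the product rule for \<open>det\<close>.\<close>

definition trunc :: "'n set \<Rightarrow> ('k::zero_neq_one, 'n::finite) sqmat \<Rightarrow> ('k, 'n) sqmat"
  where "trunc S A = (\<chi> i j. if i \<in> S \<and> j \<in> S then A $ i $ j else if i = j then 1 else 0)"

text \<open>A permutation that moves an index outside \<open>S\<close> picks an off-diagonal zero of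
  the padding.\<close>

lemma principal_minor_eq_det: "principal_minor A S = det (trunc S A)"
  unfolding principal_minor_def det_def
proof (rule sum.mono_neutral_cong_left)
  show "{p. p permutes S} \<subseteq> {p. p permutes UNIV}"
    using permutes_subset by blast
  show "\<forall>p\<in>{p. p permutes UNIV} - {p. p permutes S}.
      of_int (sign p) * (\<Prod>i\<in>UNIV. trunc S A $ i $ p i) = 0"
  proof
    fix p assume p: "p \<in> {p. p permutes UNIV} - {p. p permutes S}"
    then obtain i where i: "i \<notin> S" "p i \<noteq> i"
      unfolding permutes_def by blast
    then have "trunc S A $ i $ p i = 0" by (simp add: trunc_def)
    then have "(\<Prod>i\<in>UNIV. trunc S A $ i $ p i) = 0" by (intro prod_zero) auto
    then show "of_int (sign p) * (\<Prod>i\<in>UNIV. trunc S A $ i $ p i) = 0" by simp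
  qed
  fix p assume "p \<in> {p. p permutes S}"
  then have p: "p permutes S" by simp
  have "(\<Prod>i\<in>UNIV. trunc S A $ i $ p i) = (\<Prod>i\<in>S. trunc S A $ i $ p i)"
    by (rule prod.mono_neutral_right) (auto simp: trunc_def permutes_not_in[OF p])
  also have "\<dots> = (\<Prod>i\<in>S. A $ i $ p i)"
    by (intro prod.cong refl) (auto simp: trunc_def permutes_in_image[OF p])
  finally show "of_int (sign p) * (\<Prod>i\<in>S. A $ i $ p i)
      = of_int (sign p) * (\<Prod>i\<in>UNIV. trunc S A $ i $ p i)" by simp
qed (use finite_permutations[of "UNIV :: 'b set"] in simp)

lemma trunc_matrix_mult:
  fixes X Y :: "('k::comm_ring_1, 'n::finite) sqmat"
  assumes "\<And>i j. i \<in> S \<Longrightarrow> j \<in> S \<Longrightarrow> A $ i $ j = (\<Sum>k\<in>S. X $ i $ k * Y $ k $ j)"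
  shows "trunc S A = trunc S X ** trunc S Y"
proof -
  have "trunc S A $ i $ j = (\<Sum>k\<in>UNIV. trunc S X $ i $ k * trunc S Y $ k $ j)" for i j
  proof (cases "i \<in> S \<and> j \<in> S")
    case True
    then have "(\<Sum>k\<in>UNIV. trunc S X $ i $ k * trunc S Y $ k $ j) = (\<Sum>k\<in>S. X $ i $ k * Y $ k $ j)"
      by (intro sum.mono_neutral_cong_right) (auto simp: trunc_def)
    then show ?thesis using True by (simp add: trunc_def assms)
  next
    case False
    then have "trunc S X $ i $ k * trunc S Y $ k $ j = (if k = i then (if i = j then 1 else 0) else 0)" for k
      by (cases "i \<in> S"; cases "j \<in> S"; cases "k \<in> S"; cases "k = i"; cases "k = j"; auto simp: trunc_def)
    then have "(\<Sum>k\<in>UNIV. trunc S X $ i $ k * trunc S Y $ k $ j)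
        = (\<Sum>k\<in>UNIV. if k = i then (if i = j then 1 else 0) else 0)"
      by (intro sum.cong refl)
    also have "\<dots> = trunc S A $ i $ j" using False by (auto simp: trunc_def)
    finally show ?thesis by (rule sym)
  qed
  then show ?thesis by (simp add: vec_eq_iff matrix_matrix_mult_def)
qed

lemma det_eq_0_imp_ker:
  fixes A :: "('k::field, 'n::finite) sqmat"
  assumes "det A = 0"
  obtains x where "x \<noteq> 0" "A *v x = 0"
  using assms invertible_det_nz[of A] invertible_left_inverse[of A] matrix_left_invertible_ker[of A] by blast

lemma continuous_on_principal_minor:
  "continuous_on U (\<lambda>A :: ('k::real_normed_field, 'n::finite) sqmat. principal_minor A S)"
  unfolding principal_minor_def
  by (intro continuous_on_sum continuous_on_mult continuous_on_prod continuous_on_const continuous_on_component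
      continuous_on_id)

section \<open>Signed Gram matrices\<close>

definition abs_diag :: "('k::rc_field, 'n::finite) sqmat \<Rightarrow> ('k, 'n) sqmat"
  where "abs_diag L = (\<chi> i j. if i = j then of_real \<bar>re (L $ i $ i)\<bar> else L $ i $ j)"

text \<open>This is \<open>B D B^H\<close>, with \<open>B\<close> the matrix
  \<open>abs_diag L\<close>, \<open>D\<close> the diagonal matrix of signs of the diagonal of
  \<open>L\<close>, and \<open>^H\<close> the conjugate transpose.\<close>

definition signed_gram :: "('k::rc_field, 'n::finite) sqmat \<Rightarrow> ('k, 'n) sqmat"
  where "signed_gram L = (\<chi> i j. \<Sum>k\<in>UNIV. of_real (sgn (re (L $ k $ k)))
    * (abs_diag L $ i $ k * conjugate (abs_diag L $ j $ k)))"

lemma signed_gram_hermitian: "signed_gram L \<in> hermitian"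
  by (simp add: hermitian_def conj_transpose_def signed_gram_def vec_eq_iff sum_conjugate
      conjugate_dist_mul conjugate_of_real mult.commute)

lemma signed_gram_eq_gram:
  assumes "\<And>j. 0 < re (L $ j $ j)" "\<And>j. L $ j $ j \<in> \<real>"
  shows "signed_gram L = L ** conj_transpose L"
proof -
  have "abs_diag L = L"
    using assms(2)[THEN iffD1[OF Reals_eq_of_real_re], symmetric]
    by (simp add: abs_diag_def vec_eq_iff abs_of_pos assms(1))
  then show ?thesis
    by (simp add: signed_gram_def vec_eq_iff matrix_matrix_mult_def conj_transpose_def sgn_pos[OF assms(1)])
qed

lemma smooth_on_of_real:
  "smooth_on V U f \<Longrightarrow> smooth_on V U (\<lambda>x. of_real (f x) :: 'a::real_normed_algebra_1)"
  by (rule smooth_on_linear_compose[OF bounded_linear_of_real])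

lemma smooth_on_signed_gram:
  assumes "smooth_on V U f" "\<And>x j. x \<in> U \<Longrightarrow> re (f x $ j $ j) \<noteq> 0"
  shows "smooth_on V U (\<lambda>x. signed_gram (f x))"
proof -
  have e: "smooth_on V U (\<lambda>x. f x $ i $ j)" for i j by (intro smooth_on_vec_nth assms)
  have re: "smooth_on V U (\<lambda>x. re (f x $ j $ j))" for j
    by (intro smooth_on_linear_compose[OF bounded_linear_re] e)
  have a: "smooth_on V U (\<lambda>x. abs_diag (f x) $ i $ j)" for i j
    unfolding abs_diag_def vec_lambda_beta
    by (intro smooth_on_if smooth_on_of_real smooth_on_abs re e assms(2))
  show ?thesis
  proof (intro smooth_on_vec)
    fix i j
    show "smooth_on V U (\<lambda>x. signed_gram (f x) $ i $ j)"
      unfolding signed_gram_def vec_lambda_beta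
      by (intro smooth_on_sum smooth_on_mult smooth_on_of_real smooth_on_sgn re a assms(2)
          smooth_on_linear_compose[OF bounded_linear_conjugate])
  qed
qed

text \<open>In the coordinates \<open>y = B^H x\<close> the form is diagonal, so the signs alone
  decide about positivity once \<open>B\<close> is invertible.\<close>

lemma hermitian_form_signed_gram:
  fixes L :: "('k::rc_field, 'n::finite) sqmat"
  shows "(\<Sum>i\<in>UNIV. \<Sum>j\<in>UNIV. conjugate (x $ i) * signed_gram L $ i $ j * x $ j)
    = of_real (\<Sum>k\<in>UNIV. sgn (re (L $ k $ k)) * (norm ((conj_transpose (abs_diag L) *v x) $ k))\<^sup>2)"
proof -
  let ?s = "\<lambda>k. of_real (sgn (re (L $ k $ k))) :: 'k"
  let ?B = "abs_diag L"
  let ?y = "\<lambda>k. (conj_transpose ?B *v x) $ k"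
  have y: "?y k = (\<Sum>j\<in>UNIV. conjugate (?B $ j $ k) * x $ j)" for k
    by (simp add: conj_transpose_def matrix_vector_mult_def)
  have "(\<Sum>i\<in>UNIV. \<Sum>j\<in>UNIV. conjugate (x $ i) * signed_gram L $ i $ j * x $ j)
      = (\<Sum>i\<in>UNIV. \<Sum>j\<in>UNIV. \<Sum>k\<in>UNIV. ?s k * ((conjugate (x $ i) * ?B $ i $ k) * (conjugate (?B $ j $ k) * x $ j)))"
    by (simp add: signed_gram_def sum_distrib_left sum_distrib_right ac_simps)
  also have "\<dots> = (\<Sum>i\<in>UNIV. \<Sum>k\<in>UNIV. \<Sum>j\<in>UNIV. ?s k * ((conjugate (x $ i) * ?B $ i $ k) * (conjugate (?B $ j $ k) * x $ j)))"
    by (intro sum.cong refl sum.swap)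
  also have "\<dots> = (\<Sum>k\<in>UNIV. \<Sum>i\<in>UNIV. \<Sum>j\<in>UNIV. ?s k * ((conjugate (x $ i) * ?B $ i $ k) * (conjugate (?B $ j $ k) * x $ j)))"
    by (rule sum.swap)
  also have "\<dots> = (\<Sum>k\<in>UNIV. ?s k * ((\<Sum>i\<in>UNIV. conjugate (x $ i) * ?B $ i $ k) * (\<Sum>j\<in>UNIV. conjugate (?B $ j $ k) * x $ j)))"
    by (simp only: sum_product) (simp only: sum_distrib_left)
  also have "\<dots> = (\<Sum>k\<in>UNIV. ?s k * (conjugate (?y k) * ?y k))"
    by (intro sum.cong refl arg_cong2[where f = "(*)"])
      (simp_all add: y sum_conjugate conjugate_dist_mul mult.commute)
  also have "\<dots> = of_real (\<Sum>k\<in>UNIV. sgn (re (L $ k $ k)) * (norm (?y k))\<^sup>2)"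
    unfolding conjugate_mult_self by simp
  finally show ?thesis .
qed

section \<open>Triangular factorization along a linear order\<close>

text \<open>Leading minors belong to \<open><\<close> and trailing ones to \<open>>\<close>.
  Abstracting the order as a parameter lets one elimination serve both on the same index
  type.\<close>

locale finite_linear_order =
  fixes r :: "'n::finite \<Rightarrow> 'n \<Rightarrow> bool"
  assumes irrefl: "\<not> r i i" and trans: "r i j \<Longrightarrow> r j k \<Longrightarrow> r i k"
    and total: "i \<noteq> j \<Longrightarrow> r i j \<or> r j i"
begin

lemma asym: "r i j \<Longrightarrow> \<not> r j i"
  using trans irrefl by blast

lemma rank_less: "r i j \<Longrightarrow> card {k. r k i} < card {k. r k j}"
  by (rule psubset_card_mono) (simp, use irrefl trans in blast)

lemma order_induct: "(\<And>j. (\<And>k. r k j \<Longrightarrow> P k) \<Longrightarrow> P j) \<Longrightarrow> P j"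
  by (induction "card {k. r k j}" arbitrary: j rule: less_induct) (use rank_less in blast)

definition tri_nz :: "('k::rc_field, 'n) sqmat set"
  where "tri_nz = {L. (\<forall>i j. r i j \<longrightarrow> L $ i $ j = 0) \<and> (\<forall>j. L $ j $ j \<in> \<real> \<and> L $ j $ j \<noteq> 0)}"

text \<open>The index set is the initial segment ending at \<open>k\<close>: it is
  \<open>{..k}\<close> for the given order and \<open>{k..}\<close> for its reverse.\<close>

definition cone :: "('k::rc_field, 'n) sqmat set"
  where "cone = {A \<in> hermitian. \<forall>k. principal_minor A {j. \<not> r k j} \<noteq> 0}"

lemma tri_nz_re_nz:
  assumes "L \<in> tri_nz" shows "re (L $ j $ j) \<noteq> 0"
proof
  assume "re (L $ j $ j) = 0"
  moreover have "L $ j $ j = of_real (re (L $ j $ j))"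
    using assms by (intro iffD1[OF Reals_eq_of_real_re]) (simp add: tri_nz_def)
  ultimately show False using assms by (simp add: tri_nz_def)
qed

lemma abs_diag_tri: "L \<in> tri_nz \<Longrightarrow> r i j \<Longrightarrow> abs_diag L $ i $ j = 0"
  using irrefl by (auto simp: abs_diag_def tri_nz_def)

text \<open>Forward substitution along \<open>r\<close> shows that the kernel is trivial.\<close>

lemma det_tri:
  fixes X :: "('k::field, 'n) sqmat"
  assumes "\<And>i j. r i j \<Longrightarrow> X $ i $ j = 0" "\<And>j. X $ j $ j \<noteq> 0"
  shows "det X \<noteq> 0"
proof
  assume "det X = 0"
  then obtain x where x: "x \<noteq> 0" "X *v x = 0" by (rule det_eq_0_imp_ker)
  have "x $ j = 0" for j
  proof (induction j rule: order_induct)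
    case (1 j)
    have "(\<Sum>k\<in>UNIV. X $ j $ k * x $ k) = (\<Sum>k\<in>UNIV. if k = j then X $ j $ j * x $ j else 0)"
    proof (intro sum.cong refl)
      fix k show "X $ j $ k * x $ k = (if k = j then X $ j $ j * x $ j else 0)"
        using total[of k j] 1[of k] assms(1)[of j k] by auto
    qed
    moreover have "(\<Sum>k\<in>UNIV. X $ j $ k * x $ k) = 0"
      using x(2) by (simp add: matrix_vector_mult_def vec_eq_iff)
    ultimately show ?case using assms(2) by simp
  qed
  then show False using x(1) by (simp add: vec_eq_iff)
qed

lemma det_trunc_tri:
  fixes X :: "('k::field, 'n) sqmat"
  assumes "\<And>i j. r i j \<Longrightarrow> X $ i $ j = 0" "\<And>j. X $ j $ j \<noteq> 0"
  shows "det (trunc S X) \<noteq> 0"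
  by (rule det_tri) (use assms irrefl in \<open>auto simp: trunc_def\<close>)

lemma det_conj_transpose_abs_diag:
  fixes L :: "('k::rc_field, 'n) sqmat"
  assumes "L \<in> tri_nz"
  shows "det (trunc S (conj_transpose (abs_diag L))) \<noteq> 0"
proof -
  have "trunc S (conj_transpose (abs_diag L)) = transpose (trunc S (\<chi> i j. conjugate (abs_diag L $ i $ j)))"
    by (auto simp: trunc_def conj_transpose_def transpose_def vec_eq_iff)
  moreover have "det (trunc S (\<chi> i j. conjugate (abs_diag L $ i $ j))) \<noteq> 0"
    by (rule det_trunc_tri) (use abs_diag_tri[OF assms] tri_nz_re_nz[OF assms] in \<open>auto simp: abs_diag_def\<close>)
  ultimately show ?thesis by simp
qed

lemma signed_gram_in_cone:
  fixes L :: "('k::rc_field, 'n) sqmat"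
  assumes L: "L \<in> tri_nz"
  shows "signed_gram L \<in> cone"
proof -
  have "principal_minor (signed_gram L) {j. \<not> r k j} \<noteq> 0" for k
  proof -
    let ?S = "{j. \<not> r k j}"
    \<comment> \<open>The factor \<open>B D\<close>. Rows in an initial segment vanish in all later
      columns, so the block of the product is the product of the blocks, both with nonzero
      determinant.\<close>
    define X where "X = (\<chi> i j. of_real (sgn (re (L $ j $ j))) * abs_diag L $ i $ j)"
    have "signed_gram L $ i $ j = (\<Sum>m\<in>?S. X $ i $ m * conj_transpose (abs_diag L) $ m $ j)"
      if "i \<in> ?S" "j \<in> ?S" for i j
    proof -
      have "abs_diag L $ i $ m = 0" if "r k m" for m
      proof (rule abs_diag_tri[OF L])
        show "r i m" using \<open>i \<in> ?S\<close> that total[of i m] trans[of k m i] by auto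
      qed
      then show ?thesis
        unfolding signed_gram_def X_def conj_transpose_def vec_lambda_beta
        by (intro sum.mono_neutral_cong_right) (auto simp: mult.assoc)
    qed
    then have "trunc ?S (signed_gram L) = trunc ?S X ** trunc ?S (conj_transpose (abs_diag L))"
      by (rule trunc_matrix_mult)
    moreover have "det (trunc ?S X) \<noteq> 0"
      by (rule det_trunc_tri) (use abs_diag_tri[OF L] tri_nz_re_nz[OF L] in \<open>auto simp: X_def abs_diag_def sgn_zero_iff\<close>)
    ultimately show ?thesis
      using det_conj_transpose_abs_diag[OF L] by (simp add: principal_minor_eq_det det_mul)
  qed
  then show ?thesis by (simp add: cone_def signed_gram_hermitian)
qed

text \<open>\<open>R\<close> removes the contributions of the columns before \<open>j\<close>. Those
  after \<open>j\<close> vanish because \<open>L $ j $ k = 0\<close> for them, so only column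
  \<open>j\<close> is left. Its pivot determines the signed diagonal entry, and that entry then
  determines the rest of the column.\<close>

lemma signed_gram_column:
  fixes L :: "('k::rc_field, 'n) sqmat"
  assumes L: "L \<in> tri_nz"
  defines "R \<equiv> \<lambda>i j. signed_gram L $ i $ j
    - (\<Sum>k | r k j. of_real (sgn (re (L $ k $ k))) * (L $ i $ k * conjugate (L $ j $ k)))"
  shows "re (R j j) = re (L $ j $ j) * \<bar>re (L $ j $ j)\<bar>"
    and "r j i \<Longrightarrow> R i j = of_real (re (L $ j $ j)) * L $ i $ j"
proof -
  have R: "R i j = of_real (sgn (re (L $ j $ j))) * (abs_diag L $ i $ j * of_real \<bar>re (L $ j $ j)\<bar>)"
    if "i = j \<or> r j i" for i j
  proof -
    let ?f = "\<lambda>k. of_real (sgn (re (L $ k $ k))) * (abs_diag L $ i $ k * conjugate (abs_diag L $ j $ k))"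
    have "?f k = 0" if "\<not> r k j" "k \<noteq> j" for k
      using that total[of k j] abs_diag_tri[OF L, of j k] by simp
    then have "sum ?f UNIV = sum ?f (insert j {k. r k j})"
      by (intro sum.mono_neutral_right) auto
    also have "\<dots> = ?f j + sum ?f {k. r k j}" using irrefl by simp
    also have "sum ?f {k. r k j}
        = (\<Sum>k | r k j. of_real (sgn (re (L $ k $ k))) * (L $ i $ k * conjugate (L $ j $ k)))"
      using that irrefl trans by (intro sum.cong refl) (auto simp: abs_diag_def)
    finally have "R i j = ?f j" by (simp add: R_def signed_gram_def)
    then show ?thesis by (simp add: abs_diag_def conjugate_of_real)
  qed
  have "R j j = of_real (sgn (re (L $ j $ j)) * (\<bar>re (L $ j $ j)\<bar> * \<bar>re (L $ j $ j)\<bar>))"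
    using R[of j j] by (simp only: abs_diag_def vec_lambda_beta of_real_mult if_True simp_thms)
  then show "re (R j j) = re (L $ j $ j) * \<bar>re (L $ j $ j)\<bar>"
    by (simp only: re_of_real mult.assoc[symmetric] sgn_mult_abs)
  assume "r j i"
  then have "R i j = of_real (sgn (re (L $ j $ j)) * \<bar>re (L $ j $ j)\<bar>) * L $ i $ j"
    using R[of i j] irrefl by (auto simp: abs_diag_def)
  then show "R i j = of_real (re (L $ j $ j)) * L $ i $ j" by (simp only: sgn_mult_abs)
qed

text \<open>Recovers a signed diagonal entry from its pivot \<open>x * |x|\<close>, by operations
  that are smooth away from zero.\<close>

lemma signed_sqrt: "(x::real) = sgn (x * \<bar>x\<bar>) * sqrt \<bar>x * \<bar>x\<bar>\<bar>"
  by (cases "x = 0") (auto simp: abs_mult sgn_mult real_sqrt_mult sgn_mult_abs)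

text \<open>By induction over the columns: once the earlier columns agree, so do the residuals
  \<open>R\<close>, and these determine column \<open>j\<close>.\<close>

lemma inj_on_signed_gram: "inj_on signed_gram (tri_nz :: ('k::rc_field, 'n) sqmat set)"
proof (rule inj_onI)
  fix L K :: "('k, 'n) sqmat"
  assume L: "L \<in> tri_nz" and K: "K \<in> tri_nz" and eq: "signed_gram L = signed_gram K"
  have "\<forall>i. L $ i $ j = K $ i $ j" for j
  proof (induction j rule: order_induct)
    case (1 j)
    have s: "(\<Sum>k | r k j. of_real (sgn (re (L $ k $ k))) * (L $ i $ k * conjugate (L $ j $ k)))
        = (\<Sum>k | r k j. of_real (sgn (re (K $ k $ k))) * (K $ i $ k * conjugate (K $ j $ k)))" for i
      using 1 by (intro sum.cong) auto
    have "re (L $ j $ j) * \<bar>re (L $ j $ j)\<bar> = re (K $ j $ j) * \<bar>re (K $ j $ j)\<bar>"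
      unfolding signed_gram_column(1)[OF L, symmetric] signed_gram_column(1)[OF K, symmetric] eq s ..
    then have re: "re (L $ j $ j) = re (K $ j $ j)"
      using signed_sqrt[of "re (L $ j $ j)"] signed_sqrt[of "re (K $ j $ j)"] by metis
    show ?case
    proof
      fix i
      consider "i = j" | "r i j" | "r j i" using total by blast
      then show "L $ i $ j = K $ i $ j"
      proof cases
        case 1
        have "L $ j $ j = of_real (re (L $ j $ j))" "K $ j $ j = of_real (re (K $ j $ j))"
          using L K by (auto intro!: iffD1[OF Reals_eq_of_real_re] simp: tri_nz_def)
        then show ?thesis using re 1 by metis
      next
        case 2
        then show ?thesis using L K by (simp add: tri_nz_def)
      next
        case 3
        have "of_real (re (L $ j $ j)) * L $ i $ j = of_real (re (K $ j $ j)) * K $ i $ j"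
          unfolding signed_gram_column(2)[OF L 3, symmetric] signed_gram_column(2)[OF K 3, symmetric] eq s ..
        then show ?thesis using re tri_nz_re_nz[OF K, of j] by simp
      qed
    qed
  qed
  then show "L = K" by (simp add: vec_eq_iff)
qed

text \<open>The recursion behind injectivity also expresses column \<open>j\<close> through
  \<open>A\<close> and the earlier columns by smooth operations, all roots, signs and inverses being
  taken at nonzero values. No inverse function theorem enters.\<close>

lemma smooth_on_factor:
  fixes C :: "('k::rc_field, 'n) sqmat \<Rightarrow> ('k, 'n) sqmat"
  assumes C: "\<And>A. A \<in> U \<Longrightarrow> C A \<in> tri_nz" "\<And>A. A \<in> U \<Longrightarrow> signed_gram (C A) = A"
  shows "smooth_on V U C"
proof -
  have "\<forall>i. smooth_on V U (\<lambda>A. C A $ i $ j)" for j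
  proof (induction j rule: order_induct)
    case (1 j)
    define R where "R = (\<lambda>A i. A $ i $ j
      - (\<Sum>k | r k j. of_real (sgn (re (C A $ k $ k))) * (C A $ i $ k * conjugate (C A $ j $ k))))"
    have IH: "smooth_on V U (\<lambda>A. C A $ i $ k)" if "r k j" for i k using 1[OF that] by blast
    have "smooth_on V U (\<lambda>A. of_real (sgn (re (C A $ k $ k))) * (C A $ i $ k * conjugate (C A $ j $ k)))"
      if "r k j" for i k
      using tri_nz_re_nz[OF C(1)]
      by (intro smooth_on_mult smooth_on_of_real smooth_on_sgn smooth_on_linear_compose[OF bounded_linear_re]
          smooth_on_linear_compose[OF bounded_linear_conjugate] IH that)
    then have R: "smooth_on V U (\<lambda>A. R A i)" for i
      unfolding R_def
      by (intro smooth_on_diff smooth_on_vec_nth smooth_on_id smooth_on_sum) simp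
    have col: "re (R A j) = re (C A $ j $ j) * \<bar>re (C A $ j $ j)\<bar>"
      "r j i \<Longrightarrow> R A i = of_real (re (C A $ j $ j)) * C A $ i $ j" if "A \<in> U" for A i
      using signed_gram_column[OF C(1)[OF that], of j] C(2)[OF that] by (simp_all add: R_def)
    have nz: "re (R A j) \<noteq> 0" if "A \<in> U" for A
      using col(1)[OF that] tri_nz_re_nz[OF C(1)[OF that]] by simp
    have "smooth_on V U (\<lambda>A. sgn (re (R A j)) * sqrt \<bar>re (R A j)\<bar>)"
      using nz by (intro smooth_on_mult smooth_on_sgn smooth_on_sqrt smooth_on_abs
          smooth_on_linear_compose[OF bounded_linear_re] R) auto
    then have d: "smooth_on V U (\<lambda>A. re (C A $ j $ j))"
      by (rule smooth_on_cong[rotated]) (simp only: col(1) signed_sqrt[symmetric])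
    show ?case
    proof
      fix i
      consider "i = j" | "r i j" | "r j i" using total by blast
      then show "smooth_on V U (\<lambda>A. C A $ i $ j)"
      proof cases
        case 1
        have "of_real (re (C A $ j $ j)) = C A $ j $ j" if "A \<in> U" for A
          using C(1)[OF that] by (intro iffD1[OF Reals_eq_of_real_re, symmetric]) (simp add: tri_nz_def)
        then show ?thesis
          unfolding 1 using smooth_on_of_real[OF d] by (rule smooth_on_cong)
      next
        case 2
        show ?thesis
          by (rule smooth_on_cong[OF _ smooth_on_const[of V U 0]]) (use C(1) 2 in \<open>auto simp: tri_nz_def\<close>)
      next
        case 3
        have "smooth_on V U (\<lambda>A. inverse (of_real (re (C A $ j $ j))) * R A i)"
          using tri_nz_re_nz[OF C(1)]
          by (intro smooth_on_mult smooth_on_inverse smooth_on_of_real d R) simp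
        then show ?thesis
          by (rule smooth_on_cong[rotated]) (use col(2)[OF _ 3] tri_nz_re_nz[OF C(1)] in simp)
      qed
    qed
  qed
  then show ?thesis by (intro smooth_on_vec) simp
qed

lemma finite_has_max:
  assumes "S \<noteq> {}"
  obtains j where "j \<in> S" "\<And>k. k \<in> S \<Longrightarrow> k = j \<or> r k j"
proof -
  let ?f = "\<lambda>j. card {k. r k j}"
  have "Max (?f ` S) \<in> ?f ` S" using assms by (intro Max_in) auto
  then obtain j where j: "j \<in> S" "?f j = Max (?f ` S)" by auto
  have m: "k = j \<or> r k j" if "k \<in> S" for k
  proof (rule ccontr)
    assume "\<not> (k = j \<or> r k j)"
    then have "r j k" using total by blast
    then have "?f j < ?f k" by (rule rank_less)
    moreover have "?f k \<le> Max (?f ` S)" using that by (intro Max_ge) auto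
    ultimately show False using j(2) by simp
  qed
  show ?thesis by (rule that[OF j(1) m])
qed

text \<open>
  Induction over initial segments \<open>S\<close>. In the step, \<open>R\<close> is the Schur complement with respect to
  \<open>S\<close> without its last index \<open>j\<close>; its pivot \<open>c\<close> at \<open>j\<close> cannot vanish, because otherwise the minor
  of \<open>S\<close> would.
\<close>

lemma partial_factor:
  fixes A :: "('k::rc_field, 'n) sqmat"
  assumes A: "A \<in> cone" and S: "\<And>j k. j \<in> S \<Longrightarrow> r k j \<Longrightarrow> k \<in> S"
  shows "\<exists>L. (\<forall>j\<in>S. (\<forall>i. r i j \<longrightarrow> L $ i $ j = 0) \<and> L $ j $ j \<in> \<real> \<and> L $ j $ j \<noteq> 0)
    \<and> (\<forall>i j. i \<in> S \<or> j \<in> S \<longrightarrow> A $ i $ j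
        = (\<Sum>k\<in>S. of_real (sgn (re (L $ k $ k))) * (abs_diag L $ i $ k * conjugate (abs_diag L $ j $ k))))"
  using S
proof (induction "card S" arbitrary: S)
  case 0
  then have "S = {}" by simp
  then show ?case by simp
next
  case (Suc n)
  then have "S \<noteq> {}" by auto
  then obtain j where j: "j \<in> S" "\<And>k. k \<in> S \<Longrightarrow> k = j \<or> r k j" by (rule finite_has_max) blast
  let ?T = "S - {j}"
  let ?p = "\<lambda>L i l k. of_real (sgn (re (L $ k $ k))) * (abs_diag L $ i $ k * conjugate (abs_diag L $ l $ k)) :: 'k"
  have n: "n = card ?T" using Suc.hyps(2) j(1) by simp
  have down: "k \<in> ?T" if "l \<in> ?T" "r k l" for k l
    using that Suc.prems[of l k] j(2)[of l] asym[of l j] by blast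
  obtain L where
    "(\<forall>k\<in>?T. (\<forall>i. r i k \<longrightarrow> L $ i $ k = 0) \<and> L $ k $ k \<in> \<real> \<and> L $ k $ k \<noteq> 0)
      \<and> (\<forall>i l. i \<in> ?T \<or> l \<in> ?T \<longrightarrow> A $ i $ l = (\<Sum>k\<in>?T. ?p L i l k))"
    using Suc.hyps(1)[OF n down] by (rule exE)
  then have L: "\<And>k i. k \<in> ?T \<Longrightarrow> r i k \<Longrightarrow> L $ i $ k = 0" "\<And>k. k \<in> ?T \<Longrightarrow> L $ k $ k \<in> \<real> \<and> L $ k $ k \<noteq> 0"
    and AL: "\<And>i l. i \<in> ?T \<or> l \<in> ?T \<Longrightarrow> A $ i $ l = (\<Sum>k\<in>?T. ?p L i l k)"
    by blast+
  define R where "R = (\<lambda>i l. A $ i $ l - (\<Sum>k\<in>?T. ?p L i l k))"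
  have R0: "R i l = 0" if "i \<in> ?T \<or> l \<in> ?T" for i l using AL[OF that] by (simp add: R_def)
  have conjR: "conjugate (R i l) = R l i" for i l
  proof -
    have "conjugate (A $ i $ l) = A $ l $ i" using A by (intro hermitianD) (simp add: cone_def)
    moreover have "conjugate (x - y) = conjugate x - conjugate y" for x y :: 'k
      using conjugate_dist_add[of x "- y"] by (simp add: conjugate_neg)
    ultimately show ?thesis
      by (simp add: R_def sum_conjugate conjugate_dist_mul conjugate_of_real mult.commute)
  qed
  define c where "c = re (R j j)"
  have Rjj: "R j j = of_real c" unfolding c_def using conjR[of j j] by (rule iffD1[OF conjugate_fixed_iff])
  have "c \<noteq> 0"
  proof
    assume "c = 0"
    then have R0': "R i l = 0" if "i \<in> S" "l \<in> S" for i l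
      using R0[of i l] Rjj that by (cases "i = j \<and> l = j") auto
    \<comment> \<open>If the pivot vanished, the block of \<open>S\<close> would be a product of
      \<open>S\<close>-blocks using only the columns in \<open>?T\<close>; column \<open>j\<close>
      of the left factor is set to zero, which makes it singular.\<close>
    define X where "X = (\<chi> i k. if k = j then 0 else of_real (sgn (re (L $ k $ k))) * abs_diag L $ i $ k)"
    have "A $ i $ l = (\<Sum>k\<in>S. X $ i $ k * conj_transpose (abs_diag L) $ k $ l)" if "i \<in> S" "l \<in> S" for i l
    proof -
      have "A $ i $ l = (\<Sum>k\<in>?T. ?p L i l k)" using R0'[OF that] by (simp add: R_def)
      also have "\<dots> = (\<Sum>k\<in>S. X $ i $ k * conj_transpose (abs_diag L) $ k $ l)"
        by (intro sum.mono_neutral_cong_left) (auto simp: X_def conj_transpose_def mult.assoc)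
      finally show ?thesis .
    qed
    then have "trunc S A = trunc S X ** trunc S (conj_transpose (abs_diag L))"
      by (rule trunc_matrix_mult)
    moreover have "column j (trunc S X) = 0"
      using j(1) by (auto simp: column_def trunc_def X_def vec_eq_iff)
    then have "det (trunc S X) = 0" by (rule det_zero_column(2))
    ultimately have "principal_minor A S = 0" by (simp add: principal_minor_eq_det det_mul)
    \<comment> \<open>As an initial segment with largest element \<open>j\<close>, \<open>S\<close>
      is one of the index sets in the definition of \<open>cone\<close>.\<close>
    moreover have "k \<in> S \<longleftrightarrow> \<not> r j k" for k
      using j(1) j(2)[of k] asym[of k j] irrefl[of j] total[of k j] Suc.prems[OF j(1), of k] by auto
    then have "S = {k. \<not> r j k}" by auto
    ultimately show False using A by (simp add: cone_def)
  qed
  \<comment> \<open>The signed root, chosen so that \<open>e * |e| = c\<close>; it becomes the new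
    diagonal entry.\<close>
  define e where "e = sgn c * sqrt \<bar>c\<bar>"
  have e: "e \<noteq> 0" "sgn e = sgn c" "\<bar>e\<bar> = sqrt \<bar>c\<bar>" "e * e = \<bar>c\<bar>"
    using \<open>c \<noteq> 0\<close> by (auto simp: e_def sgn_mult abs_mult sgn_if)
  define K where
    "K = (\<chi> i k. if k = j then (if i = j then of_real e else of_real (inverse e) * R i j) else L $ i $ k)"
  have "c = sgn e * (e * e)" using e(2,4) by (simp add: sgn_mult_abs)
  then have c_e: "inverse e * c = \<bar>e\<bar>" "sgn c * (inverse e * inverse e) = inverse c"
    using e(1,2) by (auto simp: field_simps sgn_if)
  have Kj: "abs_diag K $ i $ j = of_real (inverse e) * R i j" for i
  proof (cases "i = j")
    case True
    have "of_real (inverse e) * R j j = (of_real \<bar>e\<bar> :: 'k)"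
      unfolding Rjj c_e(1)[symmetric] of_real_mult ..
    then show ?thesis using True by (simp add: abs_diag_def K_def)
  qed (simp add: abs_diag_def K_def)
  have pT: "?p K i l k = ?p L i l k" if "k \<in> ?T" for i l k
    using that by (simp add: abs_diag_def K_def)
  \<comment> \<open>The new column contributes the rank-one term of Gaussian elimination. It equals
    \<open>R i l\<close> if \<open>i\<close> or \<open>l\<close> is \<open>j\<close>, since
    \<open>R j j = c\<close>, and also if one of them lies in \<open>?T\<close>, where both sides
    are zero.\<close>
  have pj: "?p K i l j = of_real (inverse c) * (R i j * R j l)" for i l
    unfolding Kj conjugate_dist_mul conjR conjugate_of_real c_e(2)[symmetric] e(2)[symmetric] of_real_mult
    by (simp add: K_def ac_simps)
  have "A $ i $ l = (\<Sum>k\<in>S. ?p K i l k)" if il: "i \<in> S \<or> l \<in> S" for i l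
  proof -
    have "(\<Sum>k\<in>S. ?p K i l k) = ?p K i l j + (\<Sum>k\<in>?T. ?p K i l k)"
      by (rule sum.remove) (use j(1) in auto)
    also have "(\<Sum>k\<in>?T. ?p K i l k) = (\<Sum>k\<in>?T. ?p L i l k)"
      by (intro sum.cong refl pT)
    also have "?p K i l j = R i l"
    proof -
      consider "i = j" | "l = j" | "i \<in> ?T" | "l \<in> ?T" using il by blast
      then show ?thesis
      proof cases
        case 1
        then show ?thesis unfolding pj 1 Rjj using \<open>c \<noteq> 0\<close> by simp
      next
        case 2
        then show ?thesis unfolding pj 2 Rjj using \<open>c \<noteq> 0\<close> by simp
      qed (simp_all add: pj R0)
    qed
    finally show ?thesis by (simp add: R_def)
  qed
  moreover have "(\<forall>i. r i k \<longrightarrow> K $ i $ k = 0) \<and> K $ k $ k \<in> \<real> \<and> K $ k $ k \<noteq> 0" if "k \<in> S" for k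
  proof (cases "k = j")
    case True
    have "K $ i $ j = 0" if "r i j" for i
    proof -
      have "i \<in> ?T" using that Suc.prems[OF j(1)] irrefl by auto
      then show ?thesis by (simp add: K_def R0)
    qed
    then show ?thesis using True e(1) by (simp add: K_def)
  next
    case False
    then have "k \<in> ?T" using that by simp
    then show ?thesis using L False by (simp add: K_def)
  qed
  ultimately show ?case by blast
qed

lemma signed_gram_image: "signed_gram ` tri_nz = (cone :: ('k::rc_field, 'n) sqmat set)"
proof (intro equalityI subsetI)
  fix A :: "('k, 'n) sqmat" assume "A \<in> cone"
  from partial_factor[OF this, of UNIV] obtain L where L: "L \<in> tri_nz"
    and A: "\<And>i j. A $ i $ j
        = (\<Sum>k\<in>UNIV. of_real (sgn (re (L $ k $ k))) * (abs_diag L $ i $ k * conjugate (abs_diag L $ j $ k)))"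
    by (auto simp: tri_nz_def)
  have "A = signed_gram L" by (simp add: vec_eq_iff signed_gram_def A)
  then show "A \<in> signed_gram ` tri_nz" using L by blast
qed (use signed_gram_in_cone in blast)

section \<open>Positive definite matrices inside the cone\<close>

text \<open>A kernel vector of a padded block is zero outside \<open>S\<close>, so it would be a
  nonzero isotropic vector of \<open>A\<close>.\<close>

lemma PD_subset_cone: "PD \<subseteq> (cone :: ('k::rc_field, 'n) sqmat set)"
proof
  fix A :: "('k, 'n) sqmat" assume A: "A \<in> PD"
  have "principal_minor A S \<noteq> 0" for S
  proof
    assume "principal_minor A S = 0"
    then obtain x where x: "x \<noteq> 0" "trunc S A *v x = 0"
      unfolding principal_minor_eq_det by (rule det_eq_0_imp_ker)
    have row: "(\<Sum>j\<in>UNIV. trunc S A $ i $ j * x $ j) = 0" for i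
      using x(2) by (simp add: matrix_vector_mult_def vec_eq_iff)
    have out: "x $ i = 0" if "i \<notin> S" for i
    proof -
      have "(\<Sum>j\<in>UNIV. trunc S A $ i $ j * x $ j) = (\<Sum>j\<in>UNIV. if j = i then x $ j else 0)"
        using that by (intro sum.cong) (auto simp: trunc_def)
      then show ?thesis using row[of i] by simp
    qed
    have "(\<Sum>j\<in>UNIV. conjugate (x $ i) * A $ i $ j * x $ j) = 0" for i
    proof (cases "i \<in> S")
      case True
      have "(\<Sum>j\<in>UNIV. conjugate (x $ i) * A $ i $ j * x $ j)
          = conjugate (x $ i) * (\<Sum>j\<in>UNIV. trunc S A $ i $ j * x $ j)"
        unfolding sum_distrib_left
        using True by (intro sum.cong) (auto simp: trunc_def out mult.assoc)
      then show ?thesis by (simp add: row)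
    qed (simp add: out)
    then show False using A x(1) unfolding PD_def by force
  qed
  then show "A \<in> cone" using A by (simp add: cone_def PD_def)
qed

lemma signed_gram_in_PD_iff:
  fixes L :: "('k::rc_field, 'n) sqmat"
  assumes L: "L \<in> tri_nz"
  shows "signed_gram L \<in> PD \<longleftrightarrow> (\<forall>j. 0 < re (L $ j $ j))"
proof -
  let ?Y = "conj_transpose (abs_diag L)"
  have "trunc UNIV ?Y = ?Y" by (simp add: trunc_def vec_eq_iff)
  then have "det ?Y \<noteq> 0" using det_conj_transpose_abs_diag[OF L, of UNIV] by simp
  then have inv: "invertible ?Y" by (simp add: invertible_det_nz)
  have pos_iff: "0 < (of_real t :: 'k) \<longleftrightarrow> 0 < t" for t
    unfolding zero_less_iff_of_real[of "of_real t :: 'k"] by auto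
  have form: "0 < (\<Sum>i\<in>UNIV. \<Sum>j\<in>UNIV. conjugate (x $ i) * signed_gram L $ i $ j * x $ j)
      \<longleftrightarrow> 0 < (\<Sum>k\<in>UNIV. sgn (re (L $ k $ k)) * (norm ((?Y *v x) $ k))\<^sup>2)" for x
    unfolding hermitian_form_signed_gram pos_iff ..
  show ?thesis
  proof
    assume PD: "signed_gram L \<in> PD"
    show "\<forall>j. 0 < re (L $ j $ j)"
    proof
      fix j
      \<comment> \<open>Column \<open>j\<close> of \<open>Z\<close> is mapped to the
        \<open>j\<close>-th unit vector, so the form at this column is exactly the sign of the
        \<open>j\<close>-th diagonal entry.\<close>
      obtain Z where "?Y ** Z = mat 1" using inv unfolding invertible_def by blast
      then have Yx: "?Y *v (Z *v axis j 1) = axis j 1"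
        by (simp add: matrix_vector_mul_assoc)
      have "Z *v axis j 1 \<noteq> 0"
      proof
        assume "Z *v axis j 1 = 0"
        then show False using Yx by simp
      qed
      then have "0 < (\<Sum>k\<in>UNIV. sgn (re (L $ k $ k)) * (norm ((?Y *v (Z *v axis j 1)) $ k))\<^sup>2)"
        using PD form[of "Z *v axis j 1"] unfolding PD_def by blast
      also have "\<dots> = (\<Sum>k\<in>UNIV. if k = j then sgn (re (L $ j $ j)) else 0)"
        unfolding Yx by (intro sum.cong) (auto simp: axis_def)
      finally show "0 < re (L $ j $ j)" by simp
    qed
  next
    assume pos: "\<forall>j. 0 < re (L $ j $ j)"
    have "0 < (\<Sum>k\<in>UNIV. sgn (re (L $ k $ k)) * (norm ((?Y *v x) $ k))\<^sup>2)" if "x \<noteq> 0" for x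
    proof -
      have "?Y *v x \<noteq> 0"
        using inv that matrix_left_invertible_ker[of ?Y] unfolding invertible_left_inverse by blast
      then obtain k where k: "(?Y *v x) $ k \<noteq> 0" by (auto simp: vec_eq_iff)
      show ?thesis
        by (rule sum_pos2[of _ k]) (use k pos in \<open>simp_all add: sgn_pos\<close>)
    qed
    then show "signed_gram L \<in> PD"
      using form unfolding PD_def by (simp add: signed_gram_hermitian)
  qed
qed

lemma PD_eq_signed_gram:
  "PD = signed_gram ` {L \<in> (tri_nz :: ('k::rc_field, 'n) sqmat set). \<forall>j. 0 < re (L $ j $ j)}"
proof (intro equalityI subsetI)
  fix A :: "('k, 'n) sqmat" assume A: "A \<in> PD"
  then have "A \<in> signed_gram ` tri_nz" unfolding signed_gram_image using PD_subset_cone by blast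
  then show "A \<in> signed_gram ` {L \<in> tri_nz. \<forall>j. 0 < re (L $ j $ j)}"
    using A signed_gram_in_PD_iff by blast
qed (use signed_gram_in_PD_iff in blast)

lemma openin_cone: "openin (top_of_set hermitian) (cone :: ('k::rc_field, 'n) sqmat set)"
proof -
  have "open (\<Inter>k. {A :: ('k, 'n) sqmat. principal_minor A {j. \<not> r k j} \<noteq> 0})"
    by (intro open_INT ballI open_Collect_neq continuous_on_principal_minor continuous_on_const) simp
  moreover have "cone = hermitian \<inter> (\<Inter>k. {A :: ('k, 'n) sqmat. principal_minor A {j. \<not> r k j} \<noteq> 0})"
    by (auto simp: cone_def)
  ultimately show ?thesis by (auto simp: openin_open)
qed

end

section \<open>Divisibility of \<open>PD\<close> and the obstruction to embeddings\<close>

lemma hom_additive_group_pow: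
  fixes f :: "'a \<Rightarrow> 'b::real_vector"
  assumes G: "monoid G" and f: "f \<in> hom G additive_group" and x: "x \<in> carrier G"
  shows "f (x [^]\<^bsub>G\<^esub> (m::nat)) = real m *\<^sub>R f x"
proof -
  interpret monoid G by (rule G)
  have mult: "f (a \<otimes>\<^bsub>G\<^esub> b) = f a + f b" if "a \<in> carrier G" "b \<in> carrier G" for a b
    using f that by (simp add: hom_def additive_group_def)
  have "f \<one>\<^bsub>G\<^esub> = 0" using mult[of "\<one>\<^bsub>G\<^esub>" "\<one>\<^bsub>G\<^esub>"] by simp
  then show ?thesis
    by (induction m) (simp_all add: mult x scaleR_left_distrib)
qed

text \<open>Lagrange's theorem in the quotient by \<open>H\<close>, whose order is the
  index.\<close>

lemma (in comm_group) pow_index_mem_subgroup: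
  assumes "subgroup H G" "x \<in> carrier G"
  shows "x [^] card (rcosets H) \<in> H"
proof -
  interpret N: normal H G by (rule subgroup_imp_normal[OF assms(1)])
  interpret Q: group "G Mod H" by (rule N.factorgroup_is_group)
  have "H #> x \<in> carrier (G Mod H)"
    using assms(2) by (auto simp: FactGroup_def RCOSETS_def)
  then have "(H #> x) [^]\<^bsub>G Mod H\<^esub> order (G Mod H) = H"
    using Q.pow_order_eq_1 by (simp add: FactGroup_def)
  then have "H #> (x [^] card (rcosets H)) = H"
    using N.FactGroup_pow[OF assms(2)] by (simp add: order_def FactGroup_def)
  then show ?thesis using coset_join1 assms by blast
qed

text \<open>The \<open>m\<close>-th power in the log-Cholesky group of the matrix with factor \<open>L\<close> has this factor.\<close>

definition lower_pow :: "nat \<Rightarrow> ('k::rc_field, 'n::{finite,linorder}) sqmat \<Rightarrow> ('k, 'n) sqmat"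
  where "lower_pow m L =
    (\<chi> i j. if j < i then of_nat m * L $ i $ j else if i = j then L $ i $ i ^ m else 0)"

lemma lower_pow_in_lower_pos:
  "L \<in> lower_pos \<Longrightarrow> lower_pow m L \<in> (lower_pos :: ('k::rc_field, 'n::{finite,linorder}) sqmat set)"
proof -
  assume L: "L \<in> lower_pos"
  have "re (L $ j $ j ^ m) = re (L $ j $ j) ^ m" for j
    using L by (induction m) (simp_all add: re_mult_Reals lower_pos_eq lower_tangent_def)
  then show ?thesis using L by (auto simp: lower_pos_eq lower_tangent_def lower_pow_def)
qed

lemma lower_pow_Suc: "lower_mult (lower_pow m L) L = lower_pow (Suc m) L"
  by (auto simp: vec_eq_iff lower_mult_nth lower_pow_def distrib_right)

lemma lower_pow_1: "L \<in> lower_pos \<Longrightarrow> lower_pow 1 L = L"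
  by (auto simp: vec_eq_iff lower_pow_def lower_pos_def not_less_iff_gr_or_eq)

text \<open>Divisibility: the strictly lower part is additive, so it is divided by \<open>m\<close>,
  and the positive diagonal entries have real \<open>m\<close>-th roots.\<close>

lemma lower_pow_surj:
  fixes L :: "('k::rc_field, 'n::{finite,linorder}) sqmat"
  assumes L: "L \<in> lower_pos" and m: "0 < m"
  obtains K where "K \<in> lower_pos" "lower_pow m K = L"
proof -
  define K :: "('k, 'n) sqmat" where "K = (\<chi> i j. if j < i then L $ i $ j / of_nat m
    else if i = j then of_real (root m (re (L $ i $ i))) else 0)"
  have pos: "0 < re (L $ j $ j)" for j using L by (simp add: lower_pos_eq)
  have up: "L $ i $ j = 0" if "i < j" for i j using L that by (simp add: lower_pos_def)
  have diag: "of_real (re (L $ j $ j)) = L $ j $ j" for j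
    using L lower_tangent_diag[of L j] by (simp add: lower_pos_eq)
  have "root m (re (L $ j $ j)) ^ m = re (L $ j $ j)" for j
    using real_root_pow_pos[OF m pos] .
  then have "lower_pow m K = L"
    using m by (auto simp: vec_eq_iff lower_pow_def K_def up diag not_less_iff_gr_or_eq simp flip: of_real_power)
  moreover have "K \<in> lower_pos"
    using m pos by (auto simp: lower_pos_eq lower_tangent_def K_def)
  ultimately show ?thesis using that by blast
qed

context cholesky_chart
begin

lemma PD_neq_M: "PD \<noteq> M"
proof -
  have "- mat 1 \<in> (lower_nz :: ('k, 'n) sqmat set)"
    by (auto simp: lower_nz_def lower_tangent_def mat_def)
  then have "\<Psi> (- mat 1) \<in> M" "C (\<Psi> (- mat 1)) = - mat 1" by (simp_all add: \<Psi>_in C_\<Psi>)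
  moreover have "- mat 1 \<notin> (lower_pos :: ('k, 'n) sqmat set)"
    by (simp add: lower_pos_eq mat_def re_minus)
  ultimately show ?thesis using PD_iff[of "\<Psi> (- mat 1)"] by metis
qed

text \<open>\<open>H\<close> is any structure with the required properties, not necessarily
  \<open>G\<close>. Its index puts the \<open>N\<close>-th power of an outside element
  \<open>a\<close> into \<open>PD\<close>, where the prescribed law yields an \<open>N\<close>-th
  root \<open>c\<close>. Then \<open>N\<close> times \<open>f a\<close> equals \<open>N\<close>
  times \<open>f c\<close>, and division by \<open>N\<close> contradicts injectivity.\<close>

lemma no_embedding:
  assumes ext: "log_cholesky_extension \<Phi> M H d' g'"
  shows "mon H (additive_group :: 'b::real_vector monoid) = {}"
proof (rule equals0I)
  fix f assume "f \<in> mon H (additive_group :: 'b monoid)"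
  then have f: "f \<in> hom H (additive_group :: 'b monoid)" and inj: "inj_on f (carrier H)"
    by (simp_all add: mon_def)
  have H: "carrier H = M" "comm_group H" "subgroup PD H" "card (rcosets\<^bsub>H\<^esub> PD) = 2 ^ CARD('n)"
    and mult: "\<And>A B. A \<in> PD \<Longrightarrow> B \<in> PD \<Longrightarrow> A \<otimes>\<^bsub>H\<^esub> B = log_cholesky_mult \<Phi> A B"
    using ext unfolding log_cholesky_extension_def by blast+
  interpret H: comm_group H by (rule H(2))
  obtain a where a: "a \<in> M" "a \<notin> PD"
    using PD_neq_M PD_iff by blast
  define N :: nat where "N = 2 ^ CARD('n)"
  have "a [^]\<^bsub>H\<^esub> N \<in> PD"
    using H.pow_index_mem_subgroup[OF H(3)] a(1) H(1,4) by (simp add: N_def)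
  then obtain L where L: "L \<in> lower_pos" "a [^]\<^bsub>H\<^esub> N = \<Psi> L" unfolding PD_eq by blast
  obtain K where K: "K \<in> lower_pos" "lower_pow N K = L"
    using lower_pow_surj[OF L(1), of N] by (auto simp: N_def)
  define c where "c = \<Psi> K"
  have c: "c \<in> PD" "c \<in> M" using K(1) by (simp_all add: c_def PD_iff \<Psi>_in C_\<Psi> lower_pos_nz)
  \<comment> \<open>Starting at exponent 1 avoids having to identify the unit of \<open>H\<close>,
    for which \<open>ext\<close> gives no formula.\<close>
  have "c [^]\<^bsub>H\<^esub> Suc m = \<Psi> (lower_pow (Suc m) K)" for m
  proof (induction m)
    case 0
    show ?case using lower_pow_1[OF K(1)] c H(1) by (simp add: c_def)
  next
    case (Suc m)
    let ?P = "lower_pow (Suc m) K"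
    have P: "?P \<in> lower_pos" by (rule lower_pow_in_lower_pos[OF K(1)])
    then have PD: "\<Psi> ?P \<in> PD" unfolding PD_eq by blast
    have "c [^]\<^bsub>H\<^esub> Suc (Suc m) = \<Psi> ?P \<otimes>\<^bsub>H\<^esub> c" using Suc by simp
    also have "\<dots> = \<Phi> (lower_mult ?P K)"
      unfolding mult[OF PD c(1)] log_cholesky_mult_def cholesky_factor_eq[OF PD] cholesky_factor_eq[OF c(1)]
      by (simp add: c_def C_\<Psi> lower_pos_nz P K(1))
    also have "\<dots> = \<Psi> (lower_pow (Suc (Suc m)) K)"
      unfolding lower_pow_Suc by (rule \<Psi>_eq_\<Phi>[OF lower_pow_in_lower_pos[OF K(1)], symmetric])
    finally show ?case .
  qed
  from this[of "N - 1"] have "c [^]\<^bsub>H\<^esub> N = a [^]\<^bsub>H\<^esub> N"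
    by (simp add: N_def K(2)[unfolded N_def] L(2)[unfolded N_def])
  then have "real N *\<^sub>R f c = real N *\<^sub>R f a"
    using hom_additive_group_pow[OF H.is_monoid f] a(1) c(2) H(1) by metis
  then have "f c = f a" by (simp add: N_def)
  then have "c = a" using inj a(1) c(2) H(1) by (simp add: inj_on_eq_iff)
  then show False using a(2) c(1) by simp
qed

end

section \<open>The charts of the leading and the trailing cone\<close>

lemma linear_conj_transpose: "linear (conj_transpose :: ('k::rc_field, 'n::finite) sqmat \<Rightarrow> _)"
  by (rule linearI) (simp_all add: conj_transpose_def vec_eq_iff conjugate_dist_add conjugate_scaleR)

lemma smooth_on_conj_transpose:
  "smooth_on V U f \<Longrightarrow> smooth_on V U (\<lambda>x. conj_transpose (f x) :: ('k::rc_field, 'n::finite) sqmat)"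
  by (rule smooth_on_linear_compose[OF linear_conv_bounded_linear[THEN iffD1, OF linear_conj_transpose]])

lemma conj_transpose_conj_transpose [simp]: "conj_transpose (conj_transpose A) = A"
  by (simp add: conj_transpose_def vec_eq_iff)

lemma smooth_on_matrix_mult:
  fixes f g :: "_ \<Rightarrow> ('k::real_normed_field, 'n::finite) sqmat"
  assumes "smooth_on V U f" "smooth_on V U g"
  shows "smooth_on V U (\<lambda>x. f x ** g x)"
proof (intro smooth_on_vec)
  fix i j
  show "smooth_on V U (\<lambda>x. (f x ** g x) $ i $ j)"
    unfolding matrix_matrix_mult_def vec_lambda_beta
    by (intro smooth_on_sum smooth_on_mult smooth_on_vec_nth assms)
qed

lemma smooth_on_UNIV_imp_differentiable:
  "smooth_on V UNIV f \<Longrightarrow> f differentiable (at x)"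
  using smooth_on_imp_has_derivative[of V UNIV f] by (metis UNIV_I differentiableI)

lemma cholesky_LPM_differentiable:
  "cholesky_LPM differentiable (at (L :: ('k::rc_field, 'n::finite) sqmat))"
  unfolding cholesky_LPM_def[abs_def]
  by (intro smooth_on_UNIV_imp_differentiable[of UNIV] smooth_on_matrix_mult smooth_on_conj_transpose smooth_on_id)

lemma cholesky_TPM_differentiable:
  "cholesky_TPM differentiable (at (L :: ('k::rc_field, 'n::finite) sqmat))"
  unfolding cholesky_TPM_def[abs_def]
  by (intro smooth_on_UNIV_imp_differentiable[of UNIV] smooth_on_matrix_mult smooth_on_conj_transpose smooth_on_id)

interpretation less: finite_linear_order "(<) :: 'n::{finite,linorder} \<Rightarrow> 'n \<Rightarrow> bool"
  by unfold_locales auto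

interpretation greater: finite_linear_order "(\<lambda>i j. j < i) :: 'n::{finite,linorder} \<Rightarrow> 'n \<Rightarrow> bool"
  by unfold_locales auto

lemma less_cone_eq: "less.cone = LPM"
  by (simp add: less.cone_def LPM_def not_less atMost_def)

lemma greater_cone_eq: "greater.cone = TPM"
  by (simp add: greater.cone_def TPM_def not_less atLeast_def)

lemma less_tri_nz_eq: "less.tri_nz = lower_nz"
  by (auto simp: less.tri_nz_def lower_nz_def lower_tangent_def)

text \<open>Triangular for the reversed order means upper triangular, so conjugate transposition
  carries the common model \<open>lower_nz\<close> to the factors used for trailing minors.\<close>

lemma greater_tri_nz_iff: "conj_transpose L \<in> greater.tri_nz \<longleftrightarrow> L \<in> lower_nz"
proof -
  have "conjugate x \<in> \<real> \<longleftrightarrow> x \<in> \<real>" for x :: 'a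
  proof -
    have "conjugate x \<in> \<real>" if "x \<in> \<real>" for x :: 'a
      using that by (auto elim!: Reals_cases simp: conjugate_of_real)
    from this[of x] this[of "conjugate x"] show ?thesis by auto
  qed
  then show ?thesis
    by (auto simp: greater.tri_nz_def lower_nz_def lower_tangent_def conj_transpose_def)
qed

lemma cholesky_chart_LPM:
  "cholesky_chart (LPM :: ('k::rc_field, 'n::{finite,linorder}) sqmat set) cholesky_LPM
    signed_gram (inv_into lower_nz signed_gram)"
proof
  note image = less.signed_gram_image[unfolded less_cone_eq less_tri_nz_eq]
  have C: "inv_into lower_nz signed_gram A \<in> lower_nz" "signed_gram (inv_into lower_nz signed_gram A) = A"
    if "A \<in> LPM" for A :: "('k, 'n) sqmat"
    using that unfolding image[symmetric] by (auto intro: inv_into_into f_inv_into_f)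
  fix A L :: "('k, 'n) sqmat"
  show "openin (top_of_set hermitian) (LPM :: ('k, 'n) sqmat set)"
    using less.openin_cone unfolding less_cone_eq .
  show "A \<in> LPM \<Longrightarrow> inv_into lower_nz signed_gram A \<in> lower_nz"
    and "A \<in> LPM \<Longrightarrow> signed_gram (inv_into lower_nz signed_gram A) = A" by (fact C)+
  show "L \<in> lower_nz \<Longrightarrow> signed_gram L \<in> LPM" using image by blast
  show "L \<in> lower_nz \<Longrightarrow> inv_into lower_nz signed_gram (signed_gram L) = L"
    using inv_into_f_f[OF less.inj_on_signed_gram] unfolding less_tri_nz_eq .
  show "smooth_on lower_tangent (lower_nz :: ('k, 'n) sqmat set) signed_gram"
    by (rule smooth_on_signed_gram[OF smooth_on_id]) (rule lower_nz_re_nz)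
  show "smooth_on hermitian (LPM :: ('k, 'n) sqmat set) (inv_into lower_nz signed_gram)"
    using C by (intro less.smooth_on_factor) (simp_all add: less_tri_nz_eq)
  show "L \<in> lower_pos \<Longrightarrow> signed_gram L = cholesky_LPM L"
    unfolding cholesky_LPM_def lower_pos_eq by (rule signed_gram_eq_gram) (auto simp: lower_tangent_def)
  have "{L \<in> lower_nz. \<forall>j. 0 < re (L $ j $ j)} = (lower_pos :: ('k, 'n) sqmat set)"
    using lower_pos_subset_lower_nz by (auto simp: lower_pos_eq lower_nz_def)
  then show "PD = signed_gram ` (lower_pos :: ('k, 'n) sqmat set)"
    using less.PD_eq_signed_gram[where 'k = 'k and 'n = 'n] unfolding less_tri_nz_eq by simp
  show "(cholesky_LPM :: ('k, 'n) sqmat \<Rightarrow> _) differentiable (at L)"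
    by (rule cholesky_LPM_differentiable)
qed

text \<open>With \<open>K = L^H\<close>, the product \<open>L^H L\<close> is \<open>K K^H\<close>
  for an upper triangular \<open>K\<close>: the factorization for the reversed order, with conjugate
  transposition inserted on the triangular side.\<close>

lemma cholesky_chart_TPM:
  "cholesky_chart (TPM :: ('k::rc_field, 'n::{finite,linorder}) sqmat set) cholesky_TPM
    (\<lambda>L. signed_gram (conj_transpose L)) (\<lambda>A. conj_transpose (inv_into greater.tri_nz signed_gram A))"
proof
  note image = greater.signed_gram_image[unfolded greater_cone_eq]
  have C: "inv_into greater.tri_nz signed_gram A \<in> greater.tri_nz"
    "signed_gram (inv_into greater.tri_nz signed_gram A) = A"
    if "A \<in> TPM" for A :: "('k, 'n) sqmat"
    using that unfolding image[symmetric] by (auto intro: inv_into_into f_inv_into_f)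
  fix A L :: "('k, 'n) sqmat"
  show "openin (top_of_set hermitian) (TPM :: ('k, 'n) sqmat set)"
    using greater.openin_cone unfolding greater_cone_eq .
  show "A \<in> TPM \<Longrightarrow> conj_transpose (inv_into greater.tri_nz signed_gram A) \<in> lower_nz"
    using C(1) unfolding greater_tri_nz_iff[symmetric] by simp
  show "A \<in> TPM \<Longrightarrow> signed_gram (conj_transpose (conj_transpose (inv_into greater.tri_nz signed_gram A))) = A"
    using C(2) by simp
  show "L \<in> lower_nz \<Longrightarrow> signed_gram (conj_transpose L) \<in> TPM"
    using image unfolding greater_tri_nz_iff[symmetric] by blast
  show "L \<in> lower_nz \<Longrightarrow> conj_transpose (inv_into greater.tri_nz signed_gram (signed_gram (conj_transpose L))) = L"
    unfolding greater_tri_nz_iff[symmetric] by (simp add: inv_into_f_f[OF greater.inj_on_signed_gram])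
  show "smooth_on lower_tangent (lower_nz :: ('k, 'n) sqmat set) (\<lambda>L. signed_gram (conj_transpose L))"
    by (rule smooth_on_signed_gram[OF smooth_on_conj_transpose[OF smooth_on_id]])
      (simp add: conj_transpose_def lower_nz_re_nz)
  show "smooth_on hermitian (TPM :: ('k, 'n) sqmat set) (\<lambda>A. conj_transpose (inv_into greater.tri_nz signed_gram A))"
    using C by (intro smooth_on_conj_transpose greater.smooth_on_factor) simp_all
  show "signed_gram (conj_transpose L) = cholesky_TPM L" if "L \<in> lower_pos"
  proof -
    have "signed_gram (conj_transpose L) = conj_transpose L ** conj_transpose (conj_transpose L)"
    proof (rule signed_gram_eq_gram)
      show "0 < re (conj_transpose L $ j $ j)" "conj_transpose L $ j $ j \<in> \<real>" for j
        using that by (auto simp: lower_pos_eq conj_transpose_def lower_tangent_def conjugate_of_real elim!: Reals_cases)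
          (metis Reals_cases Reals_of_real conjugate_of_real)
    qed
    then show ?thesis by (simp add: cholesky_TPM_def)
  qed
  have "{L \<in> greater.tri_nz. \<forall>j. 0 < re (L $ j $ j)} = conj_transpose ` (lower_pos :: ('k, 'n) sqmat set)"
  proof (intro equalityI subsetI)
    fix K :: "('k, 'n) sqmat" assume "K \<in> {L \<in> greater.tri_nz. \<forall>j. 0 < re (L $ j $ j)}"
    then have K: "conj_transpose K \<in> lower_nz" "\<And>j. 0 < re (K $ j $ j)"
      by (simp_all flip: greater_tri_nz_iff)
    then have "conj_transpose K \<in> lower_pos"
      by (simp add: lower_pos_eq lower_nz_def) (simp add: conj_transpose_def)
    then show "K \<in> conj_transpose ` lower_pos" by (metis conj_transpose_conj_transpose imageI)
  next
    fix K :: "('k, 'n) sqmat" assume "K \<in> conj_transpose ` lower_pos"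
    then obtain L where "L \<in> lower_pos" "K = conj_transpose L" by blast
    then show "K \<in> {L \<in> greater.tri_nz. \<forall>j. 0 < re (L $ j $ j)}"
      using lower_pos_subset_lower_nz greater_tri_nz_iff[of L]
      by (auto simp: lower_pos_eq) (simp add: conj_transpose_def)
  qed
  then show "PD = (\<lambda>L. signed_gram (conj_transpose L)) ` (lower_pos :: ('k, 'n) sqmat set)"
    using greater.PD_eq_signed_gram[where 'k = 'k and 'n = 'n] by (simp add: image_image)
  show "(cholesky_TPM :: ('k, 'n) sqmat \<Rightarrow> _) differentiable (at L)"
    by (rule cholesky_TPM_differentiable)
qed

theorem theorem6:
  shows
    "(\<exists>G d g. log_cholesky_extension cholesky_LPM
        (LPM :: (real, 'n::{finite,linorder}) sqmat set) G d g)
    \<and> (\<exists>G d g. log_cholesky_extension cholesky_TPM (TPM :: (real, 'n) sqmat set) G d g)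
    \<and> (\<exists>G d g. log_cholesky_extension cholesky_LPM (LPM :: (complex, 'n) sqmat set) G d g)
    \<and> (\<exists>G d g. log_cholesky_extension cholesky_TPM (TPM :: (complex, 'n) sqmat set) G d g)
    \<and> (\<forall>G d g. log_cholesky_extension cholesky_LPM (LPM :: (real, 'n) sqmat set) G d g
        \<longrightarrow> mon G (additive_group :: 'b::banach monoid) = {})
    \<and> (\<forall>G d g. log_cholesky_extension cholesky_TPM (TPM :: (real, 'n) sqmat set) G d g
        \<longrightarrow> mon G (additive_group :: 'b monoid) = {})
    \<and> (\<forall>G d g. log_cholesky_extension cholesky_LPM (LPM :: (complex, 'n) sqmat set) G d g
        \<longrightarrow> mon G (additive_group :: 'b monoid) = {})
    \<and> (\<forall>G d g. log_cholesky_extension cholesky_TPM (TPM :: (complex, 'n) sqmat set) G d g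
        \<longrightarrow> mon G (additive_group :: 'b monoid) = {})"
  by (intro conjI exI allI impI; rule
      cholesky_chart.log_cholesky_extension[OF cholesky_chart_LPM]
      cholesky_chart.log_cholesky_extension[OF cholesky_chart_TPM]
      cholesky_chart.no_embedding[OF cholesky_chart_LPM]
      cholesky_chart.no_embedding[OF cholesky_chart_TPM]) assumption?

end
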